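(* For every $\epsilon>0$ there exists $\delta$ such that Dominating Set on $n$-vertex instances $G$ given with a $(3,\delta)$-hub of size $p$ cannot be solved in time $(2-\epsilon)^p\cdot|V(G)|^{\mathcal{O}(1)}$, unless the SCC fails.
   Context: For a graph $G$, a set $Q\subseteq V(G)$ is a $(\sigma,\delta)$-hub if every connected component of $G-Q$ has at most $\sigma$ vertices and is adjacent to at most $\delta$ vertices of $Q$. Dominating Set: given a graph $G$ (and integer $k$), find a minimum set $X\subseteq V(G)$ such that every vertex is in $X$ or adjacent to a vertex of $X$. $\le d$-Set Cover: given a universe $U$, a family $\mathcal{F}$ of subsets of $U$ of size at most $d$ with $\bigcup\mathcal{F}=U$, and an integer $t$, decide whether at most $t$ sets of $\mathcal{F}$ cover $U$. SCC: for all $\epsilon>0$ there is $d\ge1$ such that no algorithm solves every $\le d$-Set Cover instance in time $(2-\epsilon)^{|U|}|U|^{\mathcal{O}(1)}$. *)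

theory Defs
  imports
    Complex_Main
    "HOL-Library.Discrete_Functions"
    "Graph_Theory.Digraph_Component"
begin

section \<open>Algorithms: random access machines with logarithmic cost\<close>

text \<open>
  Algorithms are structured programs of a random access machine under the logarithmic cost
  criterion: every operation is charged the binary length of the numbers it handles, addresses
  included. Charging one unit per operation would not do, since multiplication then builds
  numbers of exponential length in linearly many steps. Up to factors polylogarithmic in the
  running time, which are polynomial in the input size for running times of the form
  \<open>c\<^sup>n n\<^sup>O\<^sup>(\<^sup>1\<^sup>)\<close>, the model agrees with the word RAM.

  The memory is a family of infinite arrays of naturals, of which a program can mention only
  finitely many; interleaving them in a single memory changes the cost by a constant factor.
\<close>

type_synonym state = "nat \<Rightarrow> nat \<Rightarrow> nat"

datatype aop = Add | Sub | Mul | Div | Less | Eq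

datatype aexp =
    Const nat
  | Read nat aexp  \<comment> \<open>array, index\<close>
  | Op aop aexp aexp

datatype com =
    SKIP
  | Write nat aexp aexp  \<comment> \<open>array, index, value\<close>
  | Seq com com
  | IfNZ aexp com com
  | WhileNZ aexp com

fun apply_op :: "aop \<Rightarrow> nat \<Rightarrow> nat \<Rightarrow> nat" where
  "apply_op Add x y = x + y"
| "apply_op Sub x y = x - y"
| "apply_op Mul x y = x * y"
| "apply_op Div x y = x div y"
| "apply_op Less x y = of_bool (x < y)"
| "apply_op Eq x y = of_bool (x = y)"

fun aval :: "aexp \<Rightarrow> state \<Rightarrow> nat" where
  "aval (Const n) s = n"
| "aval (Read a e) s = s a (aval e s)"
| "aval (Op f e1 e2) s = apply_op f (aval e1 s) (aval e2 s)"

text \<open>Since \<open>floor_log 0 = 0\<close>, the number \<open>0\<close> has length \<open>1\<close>.\<close>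

definition blen :: "nat \<Rightarrow> nat" where
  "blen x = floor_log x + 1"

fun acost :: "aexp \<Rightarrow> state \<Rightarrow> nat" where
  "acost (Const n) s = blen n"
| "acost (Read a e) s = acost e s + blen (aval e s) + blen (s a (aval e s))"
| "acost (Op f e1 e2) s = acost e1 s + acost e2 s + blen (aval e1 s) + blen (aval e2 s)"

text \<open>\<open>exec c s T s'\<close>: started in \<open>s\<close>, the program \<open>c\<close> halts in \<open>s'\<close> after time \<open>T\<close>.\<close>

inductive exec :: "com \<Rightarrow> state \<Rightarrow> nat \<Rightarrow> state \<Rightarrow> bool" where
  SKIP: "exec SKIP s 1 s"
| Write: "exec (Write a e1 e2) s
    (acost e1 s + acost e2 s + blen (aval e1 s) + blen (aval e2 s))
    (s(a := (s a)(aval e1 s := aval e2 s)))"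
| Seq: "exec c1 s T1 s' \<Longrightarrow> exec c2 s' T2 s'' \<Longrightarrow> exec (Seq c1 c2) s (T1 + T2) s''"
| IfTrue: "aval e s \<noteq> 0 \<Longrightarrow> exec c1 s T s' \<Longrightarrow>
    exec (IfNZ e c1 c2) s (acost e s + blen (aval e s) + T) s'"
| IfFalse: "aval e s = 0 \<Longrightarrow> exec c2 s T s' \<Longrightarrow>
    exec (IfNZ e c1 c2) s (acost e s + blen (aval e s) + T) s'"
| WhileTrue: "aval e s \<noteq> 0 \<Longrightarrow> exec c s T s' \<Longrightarrow> exec (WhileNZ e c) s' T' s'' \<Longrightarrow>
    exec (WhileNZ e c) s (acost e s + blen (aval e s) + T + T') s''"
| WhileFalse: "aval e s = 0 \<Longrightarrow> exec (WhileNZ e c) s (acost e s + blen (aval e s)) s"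

inductive_cases SKIP_E: "exec SKIP s T s'"
inductive_cases Write_E: "exec (Write a e1 e2) s T s'"
inductive_cases Seq_E: "exec (Seq c1 c2) s T s'"
inductive_cases IfNZ_E: "exec (IfNZ e c1 c2) s T s'"
inductive_cases WhileNZ_E: "exec (WhileNZ e c) s T s'"

lemma exec_deterministic:
  "exec c s T s' \<Longrightarrow> exec c s U u' \<Longrightarrow> U = T \<and> u' = s'"
proof (induction arbitrary: U u' rule: exec.induct)
  case (SKIP s)
  then show ?case by (rule SKIP_E) simp
next
  case (Write a e1 e2 s)
  then show ?case by (rule Write_E) simp
next
  case (Seq c1 s T1 s' c2 T2 s'')
  from Seq.prems obtain U1 U2 v where "exec c1 s U1 v" "exec c2 v U2 u'" "U = U1 + U2"
    by (auto elim: Seq_E)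
  with Seq.IH show ?case by metis
next
  case (IfTrue e s c1 T s' c2)
  from IfTrue.prems IfTrue.hyps obtain V
    where "U = acost e s + blen (aval e s) + V" "exec c1 s V u'"
    by (auto elim: IfNZ_E)
  with IfTrue.IH show ?case by metis
next
  case (IfFalse e s c2 T s' c1)
  from IfFalse.prems IfFalse.hyps obtain V
    where "U = acost e s + blen (aval e s) + V" "exec c2 s V u'"
    by (auto elim: IfNZ_E)
  with IfFalse.IH show ?case by metis
next
  case (WhileTrue e s c T s' T' s'')
  from WhileTrue.prems obtain V v V'
    where "U = acost e s + blen (aval e s) + V + V'" "exec c s V v" "exec (WhileNZ e c) v V' u'"
    by (rule WhileNZ_E) (use WhileTrue.hyps in simp_all)
  with WhileTrue.IH show ?case by metis
next
  case (WhileFalse e s c)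
  from WhileFalse.prems show ?case
    by (rule WhileNZ_E) (use WhileFalse.hyps in simp_all)
qed

lemma exec_time_pos: "exec c s T s' \<Longrightarrow> 0 < T"
  by (induction rule: exec.induct) (auto simp: blen_def)

text \<open>
  The input is read from array \<open>0\<close>. The answer is left in array \<open>1\<close>: its first cell for a decision
  problem, and the characteristic vector of the set found for a search problem on \<open>{..<n}\<close>.
\<close>

definition input :: "nat list \<Rightarrow> state" where
  "input xs = (\<lambda>a i. if a = 0 \<and> i < length xs then xs ! i else 0)"

definition accepting :: "state \<Rightarrow> bool" where
  "accepting s \<longleftrightarrow> s 1 0 \<noteq> 0"

definition output_set :: "nat \<Rightarrow> state \<Rightarrow> nat set" where
  "output_set n s = {v. v < n \<and> s 1 v \<noteq> 0}"


section \<open>Set Cover with sets of bounded size\<close>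

definition set_cover_instance :: "nat \<Rightarrow> 'a set \<Rightarrow> 'a set set \<Rightarrow> bool" where
  "set_cover_instance d U F \<longleftrightarrow>
     finite U \<and> (\<forall>S\<in>F. S \<subseteq> U \<and> card S \<le> d) \<and> \<Union>F = U"

definition has_set_cover :: "'a set \<Rightarrow> 'a set set \<Rightarrow> nat \<Rightarrow> bool" where
  "has_set_cover U F t \<longleftrightarrow> (\<exists>C\<subseteq>F. card C \<le> t \<and> \<Union>C = U)"

text \<open>The family is given by its incidence matrix, in row-major order.\<close>

definition encode_set_cover :: "nat \<Rightarrow> nat set list \<Rightarrow> nat \<Rightarrow> nat list" where
  "encode_set_cover n Fs t =
     [n, length Fs, t] @ concat (map (\<lambda>S. map (\<lambda>u. of_bool (u \<in> S)) [0..<n]) Fs)"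

text \<open>
  Instances have universe \<open>{..<n}\<close> and a family listed, in any order, without repetitions, so that
  their size is polynomial in \<open>n\<close> for fixed \<open>d\<close>. The budget is at most the number of sets: larger
  ones do not change the answer, but reading them would take time that is not bounded in \<open>n\<close>.
\<close>

definition solves_set_cover :: "nat \<Rightarrow> com \<Rightarrow> (nat \<Rightarrow> real) \<Rightarrow> bool" where
  "solves_set_cover d P time \<longleftrightarrow>
     (\<forall>n Fs t. set_cover_instance d {..<n} (set Fs) \<and> distinct Fs \<and> t \<le> length Fs \<longrightarrow>
       (\<exists>T s. exec P (input (encode_set_cover n Fs t)) T s \<and> real T \<le> time n \<and>
              (accepting s \<longleftrightarrow> has_set_cover {..<n} (set Fs) t)))"

text \<open>
  \<open>n\<^sup>O\<^sup>(\<^sup>1\<^sup>)\<close> is rendered as \<open>K (n + 1)\<^sup>c\<close>, as \<open>n\<^sup>c\<close> would leave no time at all for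
  instances with \<open>n = 0\<close>.
\<close>

definition SCC :: bool where
  "SCC \<longleftrightarrow>
     (\<forall>\<epsilon>>0. \<exists>d\<ge>1. \<not> (\<exists>P (K::real) (c::nat).
        solves_set_cover d P (\<lambda>n. (2 - \<epsilon>) ^ n * (K * (real n + 1) ^ c))))"


section \<open>Hubs and Dominating Set\<close>

text \<open>
  A finite simple graph is a \<^locale>\<open>pair_graph\<close>, that is, a finite, loop-free symmetric digraph. The
  strongly connected components of a symmetric digraph are the connected components of the
  undirected graph.
\<close>

definition is_hub :: "nat \<Rightarrow> nat \<Rightarrow> 'a pair_pre_digraph \<Rightarrow> 'a set \<Rightarrow> bool" where
  "is_hub \<sigma> \<delta> G Q \<longleftrightarrow> Q \<subseteq> pverts G \<and>
     (\<forall>C \<in> pre_digraph.sccs_verts (with_proj G \<restriction> (pverts G - Q)).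
        card C \<le> \<sigma> \<and> card {q \<in> Q. \<exists>v\<in>C. (v, q) \<in> parcs G} \<le> \<delta>)"

definition dominating_set :: "'a pair_pre_digraph \<Rightarrow> 'a set \<Rightarrow> bool" where
  "dominating_set G X \<longleftrightarrow> X \<subseteq> pverts G \<and>
     (\<forall>v\<in>pverts G. v \<in> X \<or> (\<exists>x\<in>X. (x, v) \<in> parcs G))"

definition minimum_dominating_set :: "'a pair_pre_digraph \<Rightarrow> 'a set \<Rightarrow> bool" where
  "minimum_dominating_set G X \<longleftrightarrow>
     dominating_set G X \<and> (\<forall>Y. dominating_set G Y \<longrightarrow> card X \<le> card Y)"

definition hub_instance :: "nat \<Rightarrow> nat \<Rightarrow> nat \<Rightarrow> nat pair_pre_digraph \<Rightarrow> nat set \<Rightarrow> bool" where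
  "hub_instance \<sigma> \<delta> n G Q \<longleftrightarrow> pair_graph G \<and> pverts G = {..<n} \<and> is_hub \<sigma> \<delta> G Q"

text \<open>The hub is given by its characteristic vector and the graph by its adjacency matrix.\<close>

definition encode_hub_graph :: "nat \<Rightarrow> nat pair_pre_digraph \<Rightarrow> nat set \<Rightarrow> nat list" where
  "encode_hub_graph n G Q =
     map (\<lambda>v. of_bool (v \<in> Q)) [0..<n] @
     concat (map (\<lambda>u. map (\<lambda>v. of_bool ((u, v) \<in> parcs G)) [0..<n]) [0..<n])"

text \<open>The time bound takes the size of the hub and the number of vertices.\<close>

definition solves_dominating_set ::
    "nat \<Rightarrow> nat \<Rightarrow> com \<Rightarrow> (nat \<Rightarrow> nat \<Rightarrow> real) \<Rightarrow> bool" where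
  "solves_dominating_set \<sigma> \<delta> P time \<longleftrightarrow>
     (\<forall>n G Q. hub_instance \<sigma> \<delta> n G Q \<longrightarrow>
       (\<exists>T s. exec P (input (n # encode_hub_graph n G Q)) T s \<and>
              real T \<le> time (card Q) n \<and>
              minimum_dominating_set G (output_set n s)))"

text \<open>In the decision version, the budget is bounded for the same reason as in Set Cover.\<close>

definition decides_dominating_set ::
    "nat \<Rightarrow> nat \<Rightarrow> com \<Rightarrow> (nat \<Rightarrow> nat \<Rightarrow> real) \<Rightarrow> bool" where
  "decides_dominating_set \<sigma> \<delta> P time \<longleftrightarrow>
     (\<forall>n G Q k. hub_instance \<sigma> \<delta> n G Q \<and> k \<le> n \<longrightarrow>
       (\<exists>T s. exec P (input (n # k # encode_hub_graph n G Q)) T s \<and>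
              real T \<le> time (card Q) n \<and>
              (accepting s \<longleftrightarrow> (\<exists>X. dominating_set G X \<and> card X \<le> k))))"

end

theory Submission
  imports Defs
begin

text \<open>
  Each set \<open>S\<^sub>j\<close> of a set cover instance on \<open>{..<n}\<close> with \<open>m\<close> sets becomes a path on the three
  vertices \<open>n + j\<close>, \<open>n + m + j\<close>, \<open>n + 2 m + j\<close>, whose first vertex is adjacent to the elements of
  \<open>S\<^sub>j\<close>. The elements form a hub of size exactly \<open>n\<close>, whose removal leaves the paths. Dominating the
  last vertices of the paths costs \<open>m\<close> vertices and may as well be done by the middle ones, which
  dominate the paths; every further vertex then does no better than the first vertex of a path.
  Hence a cover by \<open>t\<close> sets exists iff \<open>m + t\<close> vertices dominate the graph. As \<open>m \<le> (n + 1)\<^sup>d\<close>, the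
  graph has polynomial size in \<open>n\<close>.

  On the machine, the adjacency matrix is a function of the index given by a loop-free expression,
  so a single loop writes the graph. A program for Dominating Set is then run unchanged, with all
  other data kept in arrays that it does not mention. Counting the vertices of its output turns a
  program that finds a minimum dominating set into one that decides whether \<open>k\<close> vertices suffice.
\<close>

section \<open>Hubs and families of bounded sets\<close>

lemma reachable_same_fiber:
  assumes "\<And>u v. (u, v) \<in> parcs G \<Longrightarrow> u \<in> A \<Longrightarrow> v \<in> A \<Longrightarrow> f u = f v"
    and "u \<rightarrow>\<^sup>*\<^bsub>with_proj G \<restriction> A\<^esub> v"
  shows "v \<in> A \<and> f v = f u"
  using assms(2) unfolding reachable_def
proof (induction rule: rtrancl_on_induct)
  case base
  then show ?case by simp
next
  case (step v w)
  then have "(v, w) \<in> parcs G" "v \<in> A" "w \<in> A" by (auto simp: arcs_ends_conv)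
  with step.IH show ?case using assms(1) by metis
qed

lemma is_hub_of_fibers:
  assumes Q: "Q \<subseteq> pverts G" and "finite (pverts G)"
    and arc: "\<And>u v. (u, v) \<in> parcs G \<Longrightarrow> u \<in> pverts G - Q \<Longrightarrow> v \<in> pverts G - Q \<Longrightarrow> f u = f v"
    and fiber: "\<And>u. u \<in> pverts G - Q \<Longrightarrow> card {v \<in> pverts G - Q. f v = f u} \<le> \<sigma>"
    and neighbours: "\<And>u. u \<in> pverts G - Q \<Longrightarrow>
      card {q \<in> Q. \<exists>v \<in> pverts G - Q. f v = f u \<and> (v, q) \<in> parcs G} \<le> \<delta>"
  shows "is_hub \<sigma> \<delta> G Q"
  unfolding is_hub_def
proof (intro conjI ballI)
  fix C assume C: "C \<in> pre_digraph.sccs_verts (with_proj G \<restriction> (pverts G - Q))"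
  then obtain u where "u \<in> C" by (auto simp: pre_digraph.sccs_verts_def)
  have C_fiber: "v \<in> pverts G - Q \<and> f v = f u" if "v \<in> C" for v
  proof (rule reachable_same_fiber)
    show "u \<rightarrow>\<^sup>*\<^bsub>with_proj G \<restriction> (pverts G - Q)\<^esub> v"
      using C \<open>u \<in> C\<close> that by (simp add: pre_digraph.sccs_verts_def)
  qed (rule arc)
  then have "card C \<le> card {v \<in> pverts G - Q. f v = f u}"
    by (intro card_mono) (use \<open>finite (pverts G)\<close> in auto)
  also have "\<dots> \<le> \<sigma>" using fiber C_fiber[OF \<open>u \<in> C\<close>] by simp
  finally show "card C \<le> \<sigma>" .
  have "card {q \<in> Q. \<exists>v\<in>C. (v, q) \<in> parcs G}
      \<le> card {q \<in> Q. \<exists>v \<in> pverts G - Q. f v = f u \<and> (v, q) \<in> parcs G}"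
    using C_fiber finite_subset[OF Q \<open>finite (pverts G)\<close>] by (intro card_mono) auto
  also have "\<dots> \<le> \<delta>" using neighbours C_fiber[OF \<open>u \<in> C\<close>] by simp
  finally show "card {q \<in> Q. \<exists>v\<in>C. (v, q) \<in> parcs G} \<le> \<delta>" .
qed (rule Q)

lemma card_subsets_card_le:
  assumes "finite U"
  shows "card {S. S \<subseteq> U \<and> card S \<le> d} \<le> (card U + 1) ^ d"
proof (induction d)
  case 0
  have "{S. S \<subseteq> U \<and> card S \<le> 0} = {{}}" using assms finite_subset by fastforce
  then show ?case by simp
next
  case (Suc d)
  let ?F = "\<lambda>d. {S. S \<subseteq> U \<and> card S \<le> d}"
  have fin: "finite (?F d)" using assms by simp
  have "?F (Suc d) \<subseteq> ?F d \<union> case_prod insert ` (U \<times> ?F d)"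
  proof
    fix S assume S: "S \<in> ?F (Suc d)"
    show "S \<in> ?F d \<union> case_prod insert ` (U \<times> ?F d)"
    proof (cases "S = {}")
      case False
      then obtain x where "x \<in> S" by blast
      then have "S = insert x (S - {x})" "x \<in> U" "S - {x} \<in> ?F d"
        using S by (auto simp: card_Diff_singleton)
      then show ?thesis by (intro UnI2 image_eqI[of _ _ "(x, S - {x})"]) auto
    qed simp
  qed
  then have "card (?F (Suc d)) \<le> card (?F d \<union> case_prod insert ` (U \<times> ?F d))"
    using assms fin by (intro card_mono) auto
  also have "\<dots> \<le> card (?F d) + card (case_prod insert ` (U \<times> ?F d))" by (rule card_Un_le)
  also have "\<dots> \<le> card (?F d) + card U * card (?F d)"
    using card_image_le[of "U \<times> ?F d" "case_prod insert"] assms fin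
    by (simp add: card_cartesian_product)
  also have "\<dots> = (card U + 1) * card (?F d)" by simp
  also have "\<dots> \<le> (card U + 1) ^ Suc d" unfolding power_Suc by (rule mult_le_mono2[OF Suc.IH])
  finally show ?case .
qed

lemma length_set_cover_family_le:
  assumes "set_cover_instance d U (set Fs)" "distinct Fs"
  shows "length Fs \<le> (card U + 1) ^ d"
proof -
  have "finite U" "set Fs \<subseteq> {S. S \<subseteq> U \<and> card S \<le> d}"
    using assms(1) by (auto simp: set_cover_instance_def)
  then have "card (set Fs) \<le> card {S. S \<subseteq> U \<and> card S \<le> d}" by (intro card_mono) simp_all
  also have "\<dots> \<le> (card U + 1) ^ d" by (rule card_subsets_card_le[OF \<open>finite U\<close>])
  finally show ?thesis using assms(2) by (simp add: distinct_card)
qed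

lemma has_set_cover_set_iff:
  "has_set_cover U (set Fs) t \<longleftrightarrow> (\<exists>J \<subseteq> {..<length Fs}. card J \<le> t \<and> (\<Union>j\<in>J. Fs ! j) = U)"
proof
  have set_eq: "set Fs = (!) Fs ` {..<length Fs}" by (auto simp: set_conv_nth)
  assume "has_set_cover U (set Fs) t"
  then obtain C where C: "C \<subseteq> set Fs" "card C \<le> t" "\<Union>C = U" by (auto simp: has_set_cover_def)
  then obtain J where "J \<subseteq> {..<length Fs}" "inj_on ((!) Fs) J" "C = (!) Fs ` J"
    unfolding set_eq subset_image_inj by blast
  with C(2,3) show "\<exists>J \<subseteq> {..<length Fs}. card J \<le> t \<and> (\<Union>j\<in>J. Fs ! j) = U"
    by (auto simp: card_image)
next
  assume "\<exists>J \<subseteq> {..<length Fs}. card J \<le> t \<and> (\<Union>j\<in>J. Fs ! j) = U"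
  then obtain J where J: "J \<subseteq> {..<length Fs}" "card J \<le> t" "(\<Union>j\<in>J. Fs ! j) = U" by blast
  then have "card ((!) Fs ` J) \<le> t" using card_image_le[of J "(!) Fs"] finite_subset by fastforce
  with J show "has_set_cover U (set Fs) t" unfolding has_set_cover_def
    by (intro exI[of _ "(!) Fs ` J"]) auto
qed


section \<open>The graph of a set cover instance\<close>

definition cover_edge :: "nat \<Rightarrow> nat set list \<Rightarrow> nat \<Rightarrow> nat \<Rightarrow> bool" where
  "cover_edge n Fs u v \<longleftrightarrow>
     (if u < n then n \<le> v \<and> v < n + length Fs \<and> u \<in> Fs ! (v - n) else v = u + length Fs)"

abbreviation cover_order :: "nat \<Rightarrow> nat set list \<Rightarrow> nat" where
  "cover_order n Fs \<equiv> n + 3 * length Fs"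

definition cover_graph :: "nat \<Rightarrow> nat set list \<Rightarrow> nat pair_pre_digraph" where
  "cover_graph n Fs = \<lparr>pverts = {..<cover_order n Fs},
     parcs = {(u, v). u < cover_order n Fs \<and> v < cover_order n Fs \<and>
                      (cover_edge n Fs u v \<or> cover_edge n Fs v u)}\<rparr>"

lemma pverts_cover_graph [simp]: "pverts (cover_graph n Fs) = {..<cover_order n Fs}"
  by (simp add: cover_graph_def)

lemma parcs_cover_graph [simp]:
  "(u, v) \<in> parcs (cover_graph n Fs) \<longleftrightarrow>
     u < cover_order n Fs \<and> v < cover_order n Fs \<and> (cover_edge n Fs u v \<or> cover_edge n Fs v u)"
  by (simp add: cover_graph_def)

lemma pair_graph_cover_graph: "pair_graph (cover_graph n Fs)"
proof
  show "finite (parcs (cover_graph n Fs))"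
    by (rule finite_subset[of _ "{..<cover_order n Fs} \<times> {..<cover_order n Fs}"]) auto
  show "symmetric (with_proj (cover_graph n Fs))"
    by (auto simp: symmetric_def sym_def)
qed (auto simp: cover_edge_def split: if_splits)

lemma cover_edge_same_path:
  assumes "cover_edge n Fs u v" "n \<le> u"
  shows "(u - n) mod length Fs = (v - n) mod length Fs"
proof -
  have "v - n = u - n + length Fs" using assms by (simp add: cover_edge_def)
  then show ?thesis by simp
qed

lemma path_vertex_cases:
  fixes n v m :: nat
  assumes "n \<le> v" "v < n + 3 * m"
  defines "j \<equiv> (v - n) mod m"
  shows "j < m" "v \<in> {n + j, n + m + j, n + 2 * m + j}"
proof -
  show "j < m" using assms by simp
  have "(v - n) div m < 3" using assms by (intro less_mult_imp_div_less) linarith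
  then have "(v - n) div m \<in> {0, 1, 2}" by auto
  moreover have "v = n + ((v - n) div m * m + j)" using assms(1) by (simp add: j_def)
  ultimately show "v \<in> {n + j, n + m + j, n + 2 * m + j}" by auto
qed

lemma is_hub_cover_graph:
  assumes "set_cover_instance d {..<n} (set Fs)"
  shows "is_hub 3 d (cover_graph n Fs) {..<n}"
proof (rule is_hub_of_fibers[where f = "\<lambda>v. (v - n) mod length Fs"])
  let ?m = "length Fs" and ?V = "pverts (cover_graph n Fs) - {..<n}"
  fix u assume u: "u \<in> ?V"
  define j where "j = (u - n) mod ?m"
  let ?path = "{n + j, n + ?m + j, n + 2 * ?m + j}"
  have "j < ?m" using path_vertex_cases(1)[of n u ?m] u by (simp add: j_def)
  have path: "v \<in> ?path" if "v \<in> ?V" "(v - n) mod ?m = j" for v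
    using path_vertex_cases(2)[of n v ?m] that by auto
  then have "card {v \<in> ?V. (v - n) mod ?m = j} \<le> card ?path" by (intro card_mono) auto
  also have "\<dots> \<le> 3" by (simp add: card_insert_if)
  finally show "card {v \<in> ?V. (v - n) mod ?m = (u - n) mod ?m} \<le> 3" by (simp add: j_def)
  have "{q \<in> {..<n}. \<exists>v\<in>?V. (v - n) mod ?m = j \<and> (v, q) \<in> parcs (cover_graph n Fs)} \<subseteq> Fs ! j"
    using path \<open>j < ?m\<close> by (fastforce simp: cover_edge_def)
  moreover have "finite (Fs ! j)" "card (Fs ! j) \<le> d"
    using assms \<open>j < ?m\<close> finite_subset[of "Fs ! j" "{..<n}"]
    by (auto simp: set_cover_instance_def)
  ultimately show "card {q \<in> {..<n}. \<exists>v\<in>?V. (v - n) mod ?m = (u - n) mod ?m \<and>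
      (v, q) \<in> parcs (cover_graph n Fs)} \<le> d"
    unfolding j_def by (meson card_mono le_trans)
qed (auto dest: cover_edge_same_path)

lemma hub_instance_cover_graph:
  assumes "set_cover_instance d {..<n} (set Fs)"
  shows "hub_instance 3 d (cover_order n Fs) (cover_graph n Fs) {..<n}"
  using assms by (simp add: hub_instance_def pair_graph_cover_graph is_hub_cover_graph)

lemma dominating_set_cover_graph_of_indices:
  assumes "J \<subseteq> {..<length Fs}" "(\<Union>j\<in>J. Fs ! j) = {..<n}"
  shows "dominating_set (cover_graph n Fs) ({n + length Fs..<n + 2 * length Fs} \<union> (+) n ` J)"
    (is "dominating_set _ ?X")
  unfolding dominating_set_def
proof (intro conjI ballI)
  let ?m = "length Fs"
  show "?X \<subseteq> pverts (cover_graph n Fs)" using assms(1) by auto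
  fix v assume "v \<in> pverts (cover_graph n Fs)"
  then consider (element) "v < n" | (first) "n \<le> v" "v < n + ?m"
    | (middle) "n + ?m \<le> v" "v < n + 2 * ?m" | (last) "n + 2 * ?m \<le> v" "v < n + 3 * ?m"
    using not_le by auto
  then show "v \<in> ?X \<or> (\<exists>x\<in>?X. (x, v) \<in> parcs (cover_graph n Fs))"
  proof cases
    case element
    then obtain j where "j \<in> J" "v \<in> Fs ! j" using assms(2) by blast
    then have "n + j \<in> ?X" "(n + j, v) \<in> parcs (cover_graph n Fs)"
      using element assms(1) by (auto simp: cover_edge_def)
    then show ?thesis by blast
  next
    case first
    then have "v + ?m \<in> ?X" "(v + ?m, v) \<in> parcs (cover_graph n Fs)"
      by (auto simp: cover_edge_def)
    then show ?thesis by blast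
  next
    case middle
    then show ?thesis by simp
  next
    case last
    then have "v - ?m \<in> ?X" "(v - ?m, v) \<in> parcs (cover_graph n Fs)"
      by (auto simp: cover_edge_def)
    then show ?thesis by blast
  qed
qed

text \<open>The leaf \<open>n + 2 m + j\<close> is dominated only by itself and by \<open>n + m + j\<close>.\<close>

lemma length_le_card_dominating_set_path_ends:
  assumes "dominating_set (cover_graph n Fs) X" "finite X"
  shows "length Fs \<le> card (X \<inter> {n + length Fs..})"
proof -
  let ?m = "length Fs"
  have "j \<in> (\<lambda>y. (y - n) mod ?m) ` (X \<inter> {n + ?m..})" if "j < ?m" for j
  proof -
    let ?leaf = "n + 2 * ?m + j"
    have "?leaf \<in> X \<or> (\<exists>x\<in>X. (x, ?leaf) \<in> parcs (cover_graph n Fs))"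
      using assms(1) that by (simp add: dominating_set_def)
    then have "?leaf \<in> X \<or> n + ?m + j \<in> X"
      using that by (auto simp: cover_edge_def algebra_simps split: if_splits)
    moreover have "j = (?leaf - n) mod ?m" "j = (n + ?m + j - n) mod ?m"
      using that by (simp_all add: add.assoc)
    ultimately show ?thesis by fastforce
  qed
  then have "card {..<?m} \<le> card (X \<inter> {n + ?m..})"
    using assms(2) by (intro surj_card_le) auto
  then show ?thesis by simp
qed

lemma ex_cover_indices_of_dominating_set:
  assumes cover: "\<Union>(set Fs) = {..<n}"
    and X: "dominating_set (cover_graph n Fs) X" "finite X"
  shows "\<exists>J \<subseteq> {..<length Fs}. card J \<le> card (X \<inter> {..<n + length Fs}) \<and> (\<Union>j\<in>J. Fs ! j) = {..<n}"
proof -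
  let ?m = "length Fs"
  have "\<forall>u<n. \<exists>j<?m. u \<in> Fs ! j" using cover by (metis UnionE in_set_conv_nth lessThan_iff)
  then obtain g where g: "g u < ?m \<and> u \<in> Fs ! g u" if "u < n" for u by metis
  define f where "f z = (if z < n then g z else z - n)" for z
  define J where "J = f ` (X \<inter> {..<n + ?m})"
  have J: "J \<subseteq> {..<?m}" using g by (auto simp: J_def f_def)
  moreover have "card J \<le> card (X \<inter> {..<n + ?m})"
    unfolding J_def using X(2) by (intro card_image_le) simp
  moreover have "(\<Union>j\<in>J. Fs ! j) = {..<n}"
  proof
    have "Fs ! j \<subseteq> {..<n}" if "j < ?m" for j using cover that by (metis Union_upper nth_mem)
    then show "(\<Union>j\<in>J. Fs ! j) \<subseteq> {..<n}" using J by blast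
  next
    have "\<exists>z \<in> X \<inter> {..<n + ?m}. u \<in> Fs ! f z" if "u < n" for u
    proof -
      have "u \<in> X \<or> (\<exists>x\<in>X. (x, u) \<in> parcs (cover_graph n Fs))"
        using X(1) that by (simp add: dominating_set_def)
      then show ?thesis
      proof (elim disjE bexE)
        assume "u \<in> X"
        then show ?thesis using that g by (intro bexI[of _ u]) (auto simp: f_def)
      next
        fix x assume "x \<in> X" "(x, u) \<in> parcs (cover_graph n Fs)"
        then show ?thesis using that
          by (intro bexI[of _ x]) (auto simp: f_def cover_edge_def split: if_splits)
      qed
    qed
    then show "{..<n} \<subseteq> (\<Union>j\<in>J. Fs ! j)" by (force simp: J_def)
  qed
  ultimately show ?thesis by blast
qed

lemma dominating_set_cover_graph_iff:
  assumes "\<Union>(set Fs) = {..<n}"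
  shows "(\<exists>X. dominating_set (cover_graph n Fs) X \<and> card X \<le> length Fs + t) \<longleftrightarrow>
    has_set_cover {..<n} (set Fs) t"
proof
  let ?m = "length Fs"
  assume "\<exists>X. dominating_set (cover_graph n Fs) X \<and> card X \<le> ?m + t"
  then obtain X where X: "dominating_set (cover_graph n Fs) X" "card X \<le> ?m + t" by blast
  then have "finite X" by (auto simp: dominating_set_def intro: finite_subset)
  have "X - {..<n + ?m} = X \<inter> {n + ?m..}" by auto
  then have "card X = card (X \<inter> {..<n + ?m}) + card (X \<inter> {n + ?m..})"
    using card_Int_Diff[OF \<open>finite X\<close>, of "{..<n + ?m}"] by simp
  then have "card (X \<inter> {..<n + ?m}) \<le> t"
    using length_le_card_dominating_set_path_ends[OF X(1) \<open>finite X\<close>] X(2) by linarith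
  then show "has_set_cover {..<n} (set Fs) t"
    using ex_cover_indices_of_dominating_set[OF assms X(1) \<open>finite X\<close>]
    unfolding has_set_cover_set_iff by (meson le_trans)
next
  assume "has_set_cover {..<n} (set Fs) t"
  then obtain J where J: "J \<subseteq> {..<length Fs}" "card J \<le> t" "(\<Union>j\<in>J. Fs ! j) = {..<n}"
    unfolding has_set_cover_set_iff by blast
  let ?X = "{n + length Fs..<n + 2 * length Fs} \<union> (+) n ` J"
  have "card ?X \<le> length Fs + card J"
    by (rule order_trans[OF card_Un_le]) (simp add: card_image)
  with J show "\<exists>X. dominating_set (cover_graph n Fs) X \<and> card X \<le> length Fs + t"
    using dominating_set_cover_graph_of_indices by (meson add_left_mono le_trans)
qed


section \<open>Lengths of numbers and cost of expressions\<close>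

lemma less_two_power_blen: "x < 2 ^ blen x"
  using floor_log_exp2_gt[of x] by (simp add: blen_def)

lemma blen_pos: "0 < blen x"
  by (simp add: blen_def)

lemma blen_le_iff: "0 < k \<Longrightarrow> blen x \<le> k \<longleftrightarrow> x < 2 ^ k"
proof
  assume "blen x \<le> k"
  then have "2 ^ blen x \<le> (2 :: nat) ^ k" by (rule power_increasing) simp
  with less_two_power_blen[of x] show "x < 2 ^ k" by linarith
next
  assume "0 < k" "x < 2 ^ k"
  then have "2 ^ floor_log x < (2 :: nat) ^ k" if "0 < x"
    using floor_log_exp2_le[OF that] by linarith
  then have "floor_log x < k" if "0 < x" using that by simp
  with \<open>0 < k\<close> show "blen x \<le> k" by (cases "x = 0") (simp_all add: blen_def Suc_le_eq)
qed

lemma blen_le: "x < k \<Longrightarrow> blen x \<le> k"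
  by (subst blen_le_iff) (auto intro: less_trans less_exp)

lemma blen_mono: "x \<le> y \<Longrightarrow> blen x \<le> blen y"
  by (simp add: blen_def floor_log_le_iff)

lemma blen_apply_op: "blen (apply_op f x y) \<le> blen x + blen y"
proof -
  have product: "(x + 1) * (y + 1) \<le> 2 ^ blen x * 2 ^ blen y"
    using less_two_power_blen[of x] less_two_power_blen[of y] by (intro mult_le_mono) simp_all
  have "apply_op f x y < 2 ^ blen x * 2 ^ blen y"
  proof (cases f)
    case Div
    have "x div y \<le> x" by (rule div_le_dividend)
    also have "x < (x + 1) * (y + 1)" by simp
    finally show ?thesis using Div product by simp
  next
    case Eq
    have "1 < (2 :: nat) ^ blen x * 2 ^ blen y"
      by (intro less_1_mult one_less_power blen_pos) simp_all
    with Eq show ?thesis by auto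
  qed (use product in auto)
  then show ?thesis by (simp add: blen_le_iff blen_pos power_add)
qed

definition blen_bounded :: "nat \<Rightarrow> state \<Rightarrow> bool" where
  "blen_bounded B s \<longleftrightarrow> (\<forall>a i. blen (s a i) \<le> B)"

abbreviation store :: "nat \<Rightarrow> nat \<Rightarrow> nat \<Rightarrow> state \<Rightarrow> state" where
  "store a i v s \<equiv> s(a := (s a)(i := v))"

lemma blen_bounded_update:
  "blen_bounded B s \<Longrightarrow> (\<And>i. blen (f i) \<le> B) \<Longrightarrow> blen_bounded B (s(a := f))"
  by (simp add: blen_bounded_def)

lemma blen_bounded_store: "blen_bounded B s \<Longrightarrow> blen v \<le> B \<Longrightarrow> blen_bounded B (store a i v s)"
  by (simp add: blen_bounded_def)

lemma blen_bounded_input: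
  assumes "\<And>x. x \<in> set xs \<Longrightarrow> blen x \<le> B" "0 < B"
  shows "blen_bounded B (input xs)"
  using assms by (auto simp: blen_bounded_def input_def blen_def Suc_le_eq)

fun aexp_weight :: "aexp \<Rightarrow> nat" where
  "aexp_weight (Const n) = 2 * blen n"
| "aexp_weight (Read a e) = aexp_weight e + 2"
| "aexp_weight (Op f e1 e2) = 2 * (aexp_weight e1 + aexp_weight e2)"

lemma acost_le_aexp_weight:
  assumes "blen_bounded B s"
  shows "acost e s + blen (aval e s) \<le> aexp_weight e * B"
proof (induction e)
  case (Const n)
  have "0 < B" using assms blen_pos[of "s 0 0"] unfolding blen_bounded_def by (metis less_le_trans)
  then show ?case by (cases B) simp_all
next
  case (Read a e)
  have "blen (s a (aval e s)) \<le> B" using assms by (simp add: blen_bounded_def)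
  with Read show ?case by simp
next
  case (Op f e1 e2)
  then show ?case
    using blen_apply_op[of f "aval e1 s" "aval e2 s"] by (simp add: algebra_simps)
qed


section \<open>Execution within a time bound\<close>

definition exec_within :: "com \<Rightarrow> state \<Rightarrow> nat \<Rightarrow> state \<Rightarrow> bool" where
  "exec_within c s T s' \<longleftrightarrow> (\<exists>U\<le>T. exec c s U s')"

lemma exec_within_mono: "exec_within c s T s' \<Longrightarrow> T \<le> T' \<Longrightarrow> exec_within c s T' s'"
  unfolding exec_within_def by (meson le_trans)

lemma exec_within_Seq:
  "exec_within c1 s T1 s' \<Longrightarrow> exec_within c2 s' T2 s'' \<Longrightarrow> exec_within (Seq c1 c2) s (T1 + T2) s''"
  unfolding exec_within_def by (meson add_mono exec.Seq)

text \<open>The cost of executing every instruction once, per unit of length of the numbers in memory.\<close>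

fun com_weight :: "com \<Rightarrow> nat" where
  "com_weight SKIP = 1"
| "com_weight (Write a e1 e2) = aexp_weight e1 + aexp_weight e2"
| "com_weight (Seq c1 c2) = com_weight c1 + com_weight c2"
| "com_weight (IfNZ e c1 c2) = aexp_weight e + com_weight c1 + com_weight c2"
| "com_weight (WhileNZ e c) = aexp_weight e + com_weight c"

lemma exec_within_Seq_weight:
  assumes "exec_within c1 s (com_weight c1 * B) s'" "exec_within c2 s' (com_weight c2 * B) s''"
  shows "exec_within (Seq c1 c2) s (com_weight (Seq c1 c2) * B) s''"
  using exec_within_Seq[OF assms] by (simp add: distrib_right)

lemma exec_within_weight_power2:
  assumes "exec_within c s (com_weight c * l * B) s'" "l \<le> B"
  shows "exec_within c s (com_weight c * B\<^sup>2) s'"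
  using assms(1)
proof (rule exec_within_mono)
  have "l * B \<le> B\<^sup>2" using assms(2) by (simp add: power2_eq_square)
  then show "com_weight c * l * B \<le> com_weight c * B\<^sup>2" unfolding mult.assoc by (rule mult_le_mono2)
qed

lemma exec_within_Write:
  assumes "blen_bounded B s"
  shows "exec_within (Write a e1 e2) s (com_weight (Write a e1 e2) * B)
    (store a (aval e1 s) (aval e2 s) s)"
  unfolding exec_within_def
  using acost_le_aexp_weight[OF assms, of e1] acost_le_aexp_weight[OF assms, of e2]
  by (intro exI[of _ "acost e1 s + acost e2 s + blen (aval e1 s) + blen (aval e2 s)"])
    (use exec.Write in \<open>auto simp: algebra_simps\<close>)

lemma exec_within_WhileFalse:
  assumes "blen_bounded B s" "aval e s = 0"
  shows "exec_within (WhileNZ e c) s (aexp_weight e * B) s"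
  using acost_le_aexp_weight[OF assms(1), of e] exec.WhileFalse[OF assms(2)]
  unfolding exec_within_def by blast

lemma exec_within_WhileTrue:
  assumes "blen_bounded B s" "aval e s \<noteq> 0"
    and "exec_within c s T s'" "exec_within (WhileNZ e c) s' T' s''"
  shows "exec_within (WhileNZ e c) s (aexp_weight e * B + T + T') s''"
  using acost_le_aexp_weight[OF assms(1), of e] exec.WhileTrue[OF assms(2)] assms(3,4)
  unfolding exec_within_def by (meson add_mono)

abbreviation Var :: "nat \<Rightarrow> aexp" where
  "Var r \<equiv> Read r (Const 0)"

definition increment :: "nat \<Rightarrow> com" where
  "increment r = Write r (Const 0) (Op Add (Var r) (Const 1))"

definition for_loop :: "nat \<Rightarrow> aexp \<Rightarrow> com \<Rightarrow> com" where
  "for_loop r L c = Seq (Write r (Const 0) (Const 0))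
     (WhileNZ (Op Less (Var r) L) (Seq c (increment r)))"

lemma exec_within_increment:
  assumes "blen_bounded B (store r 0 k s)"
  shows "exec_within (increment r) (store r 0 k s) (com_weight (increment r) * B)
    (store r 0 (Suc k) s)"
  using exec_within_Write[OF assms, of r "Const 0" "Op Add (Var r) (Const 1)"]
  by (simp add: increment_def)

lemma exec_within_while_less:
  assumes limit: "\<And>k. k \<le> l \<Longrightarrow> aval L (store r 0 k (g k)) = l"
    and body: "\<And>k. k < l \<Longrightarrow>
      exec_within c (store r 0 k (g k)) (com_weight c * B) (store r 0 k (g (Suc k)))"
    and bounded: "\<And>k. k \<le> l \<Longrightarrow> blen_bounded B (g k)" "blen l \<le> B"
    and "k \<le> l"
  defines "loop \<equiv> WhileNZ (Op Less (Var r) L) (Seq c (increment r))"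
  shows "exec_within loop (store r 0 k (g k))
    (aexp_weight (Op Less (Var r) L) * B + (l - k) * (com_weight loop * B)) (store r 0 l (g l))"
  using \<open>k \<le> l\<close>
proof (induction rule: inc_induct)
  case base
  have "blen_bounded B (store r 0 l (g l))" by (rule blen_bounded_store) (use bounded in simp_all)
  moreover have "aval (Op Less (Var r) L) (store r 0 l (g l)) = 0" using limit[of l] by simp
  ultimately have "exec_within loop (store r 0 l (g l)) (aexp_weight (Op Less (Var r) L) * B)
      (store r 0 l (g l))"
    unfolding loop_def by (rule exec_within_WhileFalse)
  then show ?case by (rule exec_within_mono) simp
next
  case (step k)
  have "blen k \<le> B" using blen_mono[of k l] bounded(2) step.hyps by linarith
  then have B: "blen_bounded B (store r 0 k (g k))" "blen_bounded B (store r 0 k (g (Suc k)))"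
    using bounded(1) step.hyps by (simp_all add: blen_bounded_store)
  have "exec_within (Seq c (increment r)) (store r 0 k (g k))
      (com_weight (Seq c (increment r)) * B) (store r 0 (Suc k) (g (Suc k)))"
    using step.hyps by (intro exec_within_Seq_weight[OF body exec_within_increment] B)
  moreover have "aval (Op Less (Var r) L) (store r 0 k (g k)) \<noteq> 0"
    using limit[of k] step.hyps by simp
  ultimately have "exec_within loop (store r 0 k (g k))
      (aexp_weight (Op Less (Var r) L) * B + com_weight (Seq c (increment r)) * B
        + (aexp_weight (Op Less (Var r) L) * B + (l - Suc k) * (com_weight loop * B)))
      (store r 0 l (g l))"
    using step.IH unfolding loop_def by (intro exec_within_WhileTrue[OF B(1)])
  moreover have "(l - k) * (com_weight loop * B) =
      com_weight loop * B + (l - Suc k) * (com_weight loop * B)"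
    using step.hyps by (simp flip: Suc_diff_Suc)
  ultimately show ?case by (elim exec_within_mono) (simp add: loop_def algebra_simps)
qed

lemma exec_within_for_loop:
  assumes limit: "\<And>k. k \<le> l \<Longrightarrow> aval L (store r 0 k (g k)) = l"
    and body: "\<And>k. k < l \<Longrightarrow>
      exec_within c (store r 0 k (g k)) (com_weight c * B) (store r 0 k (g (Suc k)))"
    and bounded: "\<And>k. k \<le> l \<Longrightarrow> blen_bounded B (g k)" "blen l \<le> B"
  shows "exec_within (for_loop r L c) (g 0) (com_weight (for_loop r L c) * (l + 1) * B)
    (store r 0 l (g l))"
proof -
  let ?init = "Write r (Const 0) (Const 0)"
  let ?loop = "WhileNZ (Op Less (Var r) L) (Seq c (increment r))"
  have "exec_within ?init (g 0) (com_weight ?init * B) (store r 0 0 (g 0))"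
    using exec_within_Write[OF bounded(1)[of 0], of r "Const 0" "Const 0"] by simp
  from exec_within_Seq[OF this
      exec_within_while_less[where L = L and c = c and k = 0, OF limit body bounded]]
  have "exec_within (for_loop r L c) (g 0)
      (com_weight ?init * B + (aexp_weight (Op Less (Var r) L) * B + l * (com_weight ?loop * B)))
      (store r 0 l (g l))"
    by (simp add: for_loop_def)
  then show ?thesis by (rule exec_within_mono) (simp add: for_loop_def algebra_simps)
qed

lemma exec_within_for_loop_Write:
  assumes limit: "\<And>k. k \<le> l \<Longrightarrow> aval L (store r 0 k (g k)) = l"
    and step: "\<And>k. k < l \<Longrightarrow>
      store a (aval i (store r 0 k (g k))) (aval e (store r 0 k (g k))) (store r 0 k (g k)) =
      store r 0 k (g (Suc k))"
    and bounded: "\<And>k. k \<le> l \<Longrightarrow> blen_bounded B (g k)" "blen l \<le> B"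
  shows "exec_within (for_loop r L (Write a i e)) (g 0)
    (com_weight (for_loop r L (Write a i e)) * (l + 1) * B) (store r 0 l (g l))"
proof (rule exec_within_for_loop[OF limit _ bounded])
  fix k assume "k < l"
  then have "blen k \<le> B" using blen_mono[of k l] bounded(2) by linarith
  then have "blen_bounded B (store r 0 k (g k))"
    using bounded(1) \<open>k < l\<close> by (simp add: blen_bounded_store)
  from exec_within_Write[OF this, of a i e]
  show "exec_within (Write a i e) (store r 0 k (g k)) (com_weight (Write a i e) * B)
      (store r 0 k (g (Suc k)))"
    unfolding step[OF \<open>k < l\<close>] .
qed


section \<open>Running a program next to unrelated arrays\<close>

fun aexp_arrays :: "aexp \<Rightarrow> nat set" where
  "aexp_arrays (Const n) = {}"
| "aexp_arrays (Read a e) = insert a (aexp_arrays e)"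
| "aexp_arrays (Op f e1 e2) = aexp_arrays e1 \<union> aexp_arrays e2"

fun com_arrays :: "com \<Rightarrow> nat set" where
  "com_arrays SKIP = {}"
| "com_arrays (Write a e1 e2) = insert a (aexp_arrays e1 \<union> aexp_arrays e2)"
| "com_arrays (Seq c1 c2) = com_arrays c1 \<union> com_arrays c2"
| "com_arrays (IfNZ e c1 c2) = aexp_arrays e \<union> com_arrays c1 \<union> com_arrays c2"
| "com_arrays (WhileNZ e c) = aexp_arrays e \<union> com_arrays c"

lemma finite_aexp_arrays: "finite (aexp_arrays e)"
  by (induction e) auto

lemma finite_com_arrays: "finite (com_arrays c)"
  by (induction c) (auto simp: finite_aexp_arrays)

lemma ex_fresh_array: "\<exists>x\<ge>2. com_arrays c \<subseteq> {..<x}"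
proof -
  obtain k where "\<forall>a\<in>com_arrays c. a < k"
    using finite_com_arrays[of c] by (meson finite_nat_set_iff_bounded)
  then show ?thesis by (intro exI[of _ "k + 2"]) auto
qed

lemma aval_override_on:
  "aexp_arrays e \<subseteq> A \<Longrightarrow> aval e (override_on u s A) = aval e s"
  by (induction e) auto

lemma acost_override_on:
  "aexp_arrays e \<subseteq> A \<Longrightarrow> acost e (override_on u s A) = acost e s"
  by (induction e) (auto simp: aval_override_on)

lemma exec_override_on:
  assumes "exec c s T s'" "com_arrays c \<subseteq> A"
  shows "exec c (override_on u s A) T (override_on u s' A)"
  using assms
proof (induction rule: exec.induct)
  case (SKIP s)
  show ?case by (rule exec.SKIP)
next
  case (Write a e1 e2 s)
  then have sub: "a \<in> A" "aexp_arrays e1 \<subseteq> A" "aexp_arrays e2 \<subseteq> A" by auto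
  have "(override_on u s A)(a := (s a)(i := v)) = override_on u (store a i v s) A" for i v
    using sub(1) by (auto simp: override_on_def)
  then show ?case using exec.Write[of a e1 e2 "override_on u s A"] sub
    by (simp only: aval_override_on acost_override_on override_on_apply_in)
next
  case (Seq c1 s T1 s' c2 T2 s'')
  then show ?case by (auto intro: exec.Seq)
next
  case (IfTrue e s c1 T s' c2)
  then show ?case using exec.IfTrue[of e "override_on u s A" c1]
    by (simp add: aval_override_on acost_override_on)
next
  case (IfFalse e s c2 T s' c1)
  then show ?case using exec.IfFalse[of e "override_on u s A" c2]
    by (simp add: aval_override_on acost_override_on)
next
  case (WhileTrue e s c T s' T' s'')
  then show ?case using exec.WhileTrue[of e "override_on u s A" c]
    by (simp add: aval_override_on acost_override_on)
next
  case (WhileFalse e s c)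
  then show ?case using exec.WhileFalse[of e "override_on u s A" c]
    by (simp add: aval_override_on acost_override_on)
qed

lemma exec_within_override_on:
  assumes "exec_within c s T s'" "com_arrays c \<subseteq> A" "\<And>a. a \<in> A \<Longrightarrow> u a = s a"
  shows "exec_within c u T (override_on u s' A)"
proof -
  have "override_on u s A = u" using assms(3) by (auto simp: override_on_def)
  then show ?thesis using assms(1) exec_override_on[OF _ assms(2), of s _ s' u]
    unfolding exec_within_def by auto
qed

lemma exec_blen_le_time: "exec c s T s' \<Longrightarrow> s' a i = s a i \<or> blen (s' a i) \<le> T"
proof (induction rule: exec.induct)
  case (Seq c1 s T1 s' c2 T2 s'')
  then show ?case by (metis le_add1 le_add2 le_trans)
next
  case (WhileTrue e s c T s' T' s'')
  then show ?case by (metis add.commute le_add1 le_trans trans_le_add1)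
qed auto

lemma blen_bounded_exec_within:
  assumes "exec_within c s T s'" "blen_bounded B s"
  shows "blen_bounded (B + T) s'"
  unfolding blen_bounded_def
proof (intro allI)
  fix a i
  obtain U where U: "U \<le> T" "exec c s U s'" using assms(1) by (auto simp: exec_within_def)
  have "blen (s a i) \<le> B" using assms(2) by (simp add: blen_bounded_def)
  with exec_blen_le_time[OF U(2), of a i] U(1) show "blen (s' a i) \<le> B + T" by auto
qed


section \<open>Inputs\<close>

lemma input_0: "input xs 0 = (\<lambda>i. if i < length xs then xs ! i else 0)"
  by (simp add: input_def)

lemma input_neq_0: "a \<noteq> 0 \<Longrightarrow> input xs a = (\<lambda>_. 0)"
  by (simp add: input_def)

lemma nth_concat_map:
  assumes "i < length us" "j < n"
  shows "concat (map (\<lambda>u. map (f u) [0..<n]) us) ! (i * n + j) = f (us ! i) j"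
  using assms
proof (induction us arbitrary: i)
  case (Cons u us)
  then show ?case by (cases i) (simp_all add: nth_append algebra_simps)
qed simp

lemma length_concat_map: "length (concat (map (\<lambda>u. map (f u) [0..<n]) us)) = length us * n"
  by (induction us) simp_all

lemma length_encode_hub_graph: "length (encode_hub_graph n G Q) = n + n * n"
  by (simp add: encode_hub_graph_def length_concat_map)

lemma set_encode_hub_graph: "set (encode_hub_graph n G Q) \<subseteq> {0, 1}"
  by (auto simp: encode_hub_graph_def)

lemma nth_encode_hub_graph:
  assumes "j < n + n * n"
  shows "encode_hub_graph n G Q ! j =
    (if j < n then of_bool (j \<in> Q) else of_bool (((j - n) div n, (j - n) mod n) \<in> parcs G))"
proof (cases "j < n")
  case True
  then show ?thesis by (simp add: encode_hub_graph_def nth_append)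
next
  case False
  define row where "row = (j - n) div n"
  define col where "col = (j - n) mod n"
  have "row < n" using assms False by (simp add: row_def less_mult_imp_div_less)
  moreover from this have "col < n" by (simp add: col_def)
  ultimately have "concat (map (\<lambda>u. map (\<lambda>v. of_bool ((u, v) \<in> parcs G)) [0..<n]) [0..<n]) !
      (row * n + col) = (of_bool ((row, col) \<in> parcs G) :: nat)"
    by (subst nth_concat_map) simp_all
  then show ?thesis using False
    by (simp add: encode_hub_graph_def nth_append row_def col_def)
qed


text \<open>Exceeds all numbers stored by the reductions for a graph with \<open>n\<close> vertices, hence their lengths.\<close>

definition memory_bound :: "nat \<Rightarrow> nat" where
  "memory_bound n = 4 * (n + 1)\<^sup>2"

lemma less_memory_bound: "y \<le> n + n * n + 3 \<Longrightarrow> y < memory_bound n"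
  by (simp add: memory_bound_def power2_eq_square)

lemma blen_le_memory_bound: "y \<le> n + n * n + 3 \<Longrightarrow> blen y \<le> memory_bound n"
  by (intro blen_le less_memory_bound)

lemma power2_memory_bound: "(memory_bound n)\<^sup>2 = 16 * (n + 1) ^ 4"
  by (simp add: memory_bound_def power_mult_distrib flip: power_mult)


section \<open>From finding a minimum dominating set to deciding its size\<close>

text \<open>
  Array \<open>x\<close> keeps the number of vertices and the budget, array \<open>x + 1\<close> the loop counter, and array
  \<open>x + 2\<close> the size of the set found.
\<close>

definition save_header :: "nat \<Rightarrow> com" where
  "save_header x =
     Seq (Write x (Const 0) (Read 0 (Const 0))) (Write x (Const 1) (Read 0 (Const 1)))"

definition drop_budget :: "nat \<Rightarrow> com" where
  "drop_budget x = for_loop (x + 1) (Op Add (Op Add (Var x) (Op Mul (Var x) (Var x))) (Const 1))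
     (Write 0 (Op Add (Var (x + 1)) (Const 1)) (Read 0 (Op Add (Var (x + 1)) (Const 2))))"

definition count_output :: "nat \<Rightarrow> com" where
  "count_output x = for_loop (x + 1) (Var x)
     (Write (x + 2) (Const 0) (Op Add (Var (x + 2)) (Op Less (Const 0) (Read 1 (Var (x + 1))))))"

definition compare_count :: "nat \<Rightarrow> com" where
  "compare_count x =
     Write 1 (Const 0) (Op Less (Var (x + 2)) (Op Add (Read x (Const 1)) (Const 1)))"

lemma exec_within_save_header:
  assumes "0 < x" "blen_bounded B s"
  shows "exec_within (save_header x) s (com_weight (save_header x) * B)
    (store x 1 (s 0 1) (store x 0 (s 0 0) s))"
proof -
  let ?s1 = "store x 0 (s 0 0) s"
  have "blen_bounded B ?s1" using assms(2) by (simp add: blen_bounded_def)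
  then have "exec_within (Write x (Const 1) (Read 0 (Const 1))) ?s1
      (com_weight (Write x (Const 1) (Read 0 (Const 1))) * B) (store x 1 (s 0 1) ?s1)"
    using exec_within_Write[of B ?s1 x "Const 1" "Read 0 (Const 1)"] assms(1) by simp
  moreover have "exec_within (Write x (Const 0) (Read 0 (Const 0))) s
      (com_weight (Write x (Const 0) (Read 0 (Const 0))) * B) ?s1"
    using exec_within_Write[OF assms(2), of x "Const 0" "Read 0 (Const 0)"] by simp
  ultimately show ?thesis unfolding save_header_def using exec_within_Seq_weight by blast
qed

lemma exec_within_drop_budget:
  assumes "0 < x" "s x 0 = n" and input: "s 0 = input (n # k # xs) 0"
    and length: "length xs = n + n * n"
    and bounded: "blen_bounded B s" "blen (n + n * n + 1) \<le> B"
  shows "exec_within (drop_budget x) s (com_weight (drop_budget x) * (n + n * n + 2) * B)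
    (store (x + 1) 0 (n + n * n + 1) (s(0 := input (n # xs) 0)))"
proof -
  define g where "g j = s(0 := \<lambda>i. if 1 \<le> i \<and> i \<le> j then s 0 (i + 1) else s 0 i)" for j
  have "g 0 = s" by (auto simp: g_def fun_eq_iff)
  moreover have "g (n + n * n + 1) = s(0 := input (n # xs) 0)"
    using length by (auto simp: g_def input input_0 fun_eq_iff nth_Cons' Suc_le_eq)
  moreover have "exec_within (drop_budget x) (g 0)
      (com_weight (drop_budget x) * (n + n * n + 1 + 1) * B)
      (store (x + 1) 0 (n + n * n + 1) (g (n + n * n + 1)))"
    unfolding drop_budget_def
  proof (rule exec_within_for_loop_Write)
    show "blen_bounded B (g j)" for j
      using bounded(1) by (simp add: g_def blen_bounded_def)
  qed (use assms in \<open>auto simp: g_def fun_eq_iff le_Suc_eq\<close>)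
  ultimately show ?thesis by simp
qed

lemma card_output_set_Suc:
  "card (output_set (Suc n) s) = card (output_set n s) + of_bool (0 < s 1 n)"
proof -
  have "output_set (Suc n) s = (if 0 < s 1 n then insert n (output_set n s) else output_set n s)"
    by (auto simp: output_set_def less_Suc_eq)
  moreover have "finite (output_set n s)" "n \<notin> output_set n s" by (simp_all add: output_set_def)
  ultimately show ?thesis by simp
qed

lemma card_output_set_le: "card (output_set n s) \<le> n"
  using card_mono[of "{..<n}" "output_set n s"] by (auto simp: output_set_def)

lemma exec_within_count_output:
  assumes "1 < x" "s x 0 = n" "s (x + 2) 0 = 0"
    and bounded: "blen_bounded B s" "blen n \<le> B"
  shows "exec_within (count_output x) s (com_weight (count_output x) * (n + 1) * B)
    (store (x + 1) 0 n (store (x + 2) 0 (card (output_set n s)) s))"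
proof -
  define g where "g k = store (x + 2) 0 (card (output_set k s)) s" for k
  have "g 0 = s" using \<open>s (x + 2) 0 = 0\<close> by (auto simp: g_def output_set_def fun_eq_iff)
  moreover have "exec_within (count_output x) (g 0) (com_weight (count_output x) * (n + 1) * B)
      (store (x + 1) 0 n (g n))"
    unfolding count_output_def
  proof (rule exec_within_for_loop_Write)
    show "blen_bounded B (g k)" if "k \<le> n" for k
      unfolding g_def
    proof (rule blen_bounded_store[OF bounded(1)])
      have "card (output_set k s) \<le> n" using card_output_set_le[of k s] that by linarith
      then show "blen (card (output_set k s)) \<le> B" using blen_mono bounded(2) le_trans by blast
    qed
  qed (use assms in \<open>auto simp: g_def fun_eq_iff card_output_set_Suc\<close>)
  ultimately show ?thesis by (simp add: g_def)
qed

lemma exec_within_count_compare: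
  assumes "1 < x" "s x 0 = n" "s (x + 2) 0 = 0"
    and bounded: "blen_bounded B s" "blen n \<le> B"
  defines "c \<equiv> Seq (count_output x) (compare_count x)"
  shows "\<exists>s'. exec_within c s (com_weight c * (n + 1) * B) s' \<and>
    (accepting s' \<longleftrightarrow> card (output_set n s) \<le> s x 1)"
proof (intro exI conjI)
  let ?s1 = "store (x + 1) 0 n (store (x + 2) 0 (card (output_set n s)) s)"
  let ?s2 = "store 1 0 (of_bool (card (output_set n s) \<le> s x 1)) ?s1"
  have "blen (card (output_set n s)) \<le> B"
    using blen_mono[OF card_output_set_le[of n s]] bounded(2) by linarith
  then have "blen_bounded B ?s1" using bounded by (intro blen_bounded_store)
  from exec_within_Write[OF this, of 1 "Const 0"
      "Op Less (Var (x + 2)) (Op Add (Read x (Const 1)) (Const 1))"]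
  have "exec_within (compare_count x) ?s1 (com_weight (compare_count x) * B) ?s2"
    using \<open>1 < x\<close> by (simp add: compare_count_def less_Suc_eq_le)
  from exec_within_Seq[OF exec_within_count_output[OF assms(1-5)] this]
  show "exec_within c s (com_weight c * (n + 1) * B) ?s2"
    unfolding c_def by (rule exec_within_mono) (simp add: algebra_simps)
  show "accepting ?s2 \<longleftrightarrow> card (output_set n s) \<le> s x 1"
    by (simp add: accepting_def)
qed

lemma exec_within_prepare_search:
  assumes "0 < x" and length: "length xs = n + n * n"
    and entries: "set xs \<subseteq> {0, 1}" and "k \<le> n"
  defines "c \<equiv> Seq (save_header x) (drop_budget x)" and "B \<equiv> memory_bound n"
  shows "\<exists>s. exec_within c (input (n # k # xs)) (com_weight c * B\<^sup>2) s \<and> blen_bounded B s \<and>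
    (\<forall>a<x. s a = input (n # xs) a) \<and> s x 0 = n \<and> s x 1 = k \<and> s (x + 2) 0 = 0"
proof (intro exI conjI)
  note less = less_memory_bound[of _ n, folded B_def]
    and small = blen_le_memory_bound[of _ n, folded B_def]
  let ?s0 = "input (n # k # xs)"
  let ?s1 = "store x 1 k (store x 0 n ?s0)"
  let ?s2 = "store (x + 1) 0 (n + n * n + 1) (?s1(0 := input (n # xs) 0))"
  have s0: "blen_bounded B ?s0"
    using entries \<open>k \<le> n\<close> less[of 0] by (intro blen_bounded_input small) auto
  then have s1: "blen_bounded B ?s1" using \<open>k \<le> n\<close> by (intro blen_bounded_store small) simp_all
  have "exec_within (save_header x) ?s0 (com_weight (save_header x) * 1 * B) ?s1"
    using exec_within_save_header[OF \<open>0 < x\<close> s0] by (simp add: input_def)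
  then have "exec_within (save_header x) ?s0 (com_weight (save_header x) * B\<^sup>2) ?s1"
    by (rule exec_within_weight_power2) (use less[of 0] in simp)
  moreover have "exec_within (drop_budget x) ?s1
      (com_weight (drop_budget x) * (n + n * n + 2) * B) ?s2"
    using \<open>0 < x\<close> by (intro exec_within_drop_budget[OF _ _ _ length s1 small]) auto
  then have "exec_within (drop_budget x) ?s1 (com_weight (drop_budget x) * B\<^sup>2) ?s2"
    by (rule exec_within_weight_power2) (use less[of "n + n * n + 2"] in simp)
  ultimately show "exec_within c ?s0 (com_weight c * B\<^sup>2) ?s2"
    unfolding c_def by (rule exec_within_Seq_weight)
  have "blen_bounded B (input (n # xs))"
    using entries less[of 0] by (intro blen_bounded_input small) auto
  then have "blen_bounded B (?s1(0 := input (n # xs) 0))"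
    by (intro blen_bounded_update[OF s1]) (simp add: blen_bounded_def)
  then show "blen_bounded B ?s2" by (intro blen_bounded_store small) simp_all
qed (use \<open>0 < x\<close> in \<open>auto simp: input_neq_0\<close>)

definition decide_size :: "nat \<Rightarrow> com \<Rightarrow> com" where
  "decide_size x P = Seq (Seq (save_header x) (drop_budget x))
     (Seq P (Seq (count_output x) (compare_count x)))"

lemma quadratic_overhead_le:
  fixes a B c n T :: nat
  assumes "n + 1 \<le> B"
  shows "a * B\<^sup>2 + (T + c * (n + 1) * (B + T)) \<le> (a + c + 1) * (B\<^sup>2 * (T + 1))"
proof -
  have "1 \<le> B" using assms by simp
  then have "B + T \<le> B * (T + 1)" by (simp add: algebra_simps)
  then have "(n + 1) * (B + T) \<le> B\<^sup>2 * (T + 1)"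
    unfolding power2_eq_square mult.assoc using assms by (intro mult_le_mono)
  moreover have "B\<^sup>2 \<le> B\<^sup>2 * (T + 1)" "T \<le> B\<^sup>2 * (T + 1)"
    using \<open>1 \<le> B\<close> mult_le_mono[of 1 "B\<^sup>2" T "T + 1"] by simp_all
  ultimately have "a * B\<^sup>2 + (T + c * (n + 1) * (B + T)) \<le>
      a * (B\<^sup>2 * (T + 1)) + (B\<^sup>2 * (T + 1) + c * (B\<^sup>2 * (T + 1)))"
    unfolding mult.assoc by (intro add_mono mult_le_mono2)
  then show ?thesis by (simp add: algebra_simps)
qed

lemma exec_within_decide_size:
  assumes "2 \<le> x" and fresh: "com_arrays P \<subseteq> {..<x}"
    and xs: "length xs = n + n * n" "set xs \<subseteq> {0, 1}" and "k \<le> n"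
    and P: "exec_within P (input (n # xs)) T s"
  shows "\<exists>w. exec_within (decide_size x P) (input (n # k # xs))
      (16 * (com_weight (decide_size x P) + 1) * (n + 1) ^ 4 * (T + 1)) w \<and>
    (accepting w \<longleftrightarrow> card (output_set n s) \<le> k)"
proof -
  define before where "before = Seq (save_header x) (drop_budget x)"
  define after where "after = Seq (count_output x) (compare_count x)"
  define B where "B = memory_bound n"
  have B: "n + 1 \<le> B" using less_memory_bound[of "n + 1" n] by (simp add: B_def)
  obtain u where u: "exec_within before (input (n # k # xs)) (com_weight before * B\<^sup>2) u"
    "blen_bounded B u" "\<forall>a<x. u a = input (n # xs) a" "u x 0 = n" "u x 1 = k" "u (x + 2) 0 = 0"
    using exec_within_prepare_search[OF _ xs \<open>k \<le> n\<close>, of x] \<open>2 \<le> x\<close>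
    unfolding before_def B_def by auto
  define v where "v = override_on u s {..<x}"
  have v: "exec_within P u T v"
    unfolding v_def using u(3) by (intro exec_within_override_on[OF P fresh]) simp
  have "blen n \<le> B + T" using B by (intro blen_le) linarith
  then obtain w where w: "exec_within after v (com_weight after * (n + 1) * (B + T)) w"
    "accepting w \<longleftrightarrow> card (output_set n v) \<le> v x 1"
    using exec_within_count_compare[OF _ _ _ blen_bounded_exec_within[OF v u(2)], of x n]
      \<open>2 \<le> x\<close> u(4,6) unfolding after_def v_def by auto
  have "exec_within (decide_size x P) (input (n # k # xs))
      (com_weight before * B\<^sup>2 + (T + com_weight after * (n + 1) * (B + T))) w"
    unfolding decide_size_def before_def[symmetric] after_def[symmetric]
    by (intro exec_within_Seq[OF u(1)] exec_within_Seq[OF v w(1)])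
  then have "exec_within (decide_size x P) (input (n # k # xs))
      (16 * (com_weight (decide_size x P) + 1) * (n + 1) ^ 4 * (T + 1)) w"
  proof (rule exec_within_mono)
    note quadratic_overhead_le[OF B]
    also have "(com_weight before + com_weight after + 1) * (B\<^sup>2 * (T + 1))
        \<le> (com_weight (decide_size x P) + 1) * (B\<^sup>2 * (T + 1))"
      by (intro mult_le_mono1) (simp add: decide_size_def before_def after_def)
    also have "\<dots> = 16 * (com_weight (decide_size x P) + 1) * (n + 1) ^ 4 * (T + 1)"
      by (simp only: B_def power2_memory_bound mult_ac)
    finally show "com_weight before * B\<^sup>2 + (T + com_weight after * (n + 1) * (B + T))
        \<le> 16 * (com_weight (decide_size x P) + 1) * (n + 1) ^ 4 * (T + 1)" .
  qed
  moreover have "output_set n v = output_set n s" "v x 1 = k"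
    using \<open>2 \<le> x\<close> u(5) by (simp_all add: v_def output_set_def)
  ultimately show ?thesis using w(2) by auto
qed

lemma decides_of_solves_dominating_set:
  assumes "solves_dominating_set \<sigma> \<delta> P time"
  shows "\<exists>P' C. decides_dominating_set \<sigma> \<delta> P' (\<lambda>p n. real C * (real n + 1) ^ 4 * (time p n + 1))"
proof -
  obtain x where x: "2 \<le> x" "com_arrays P \<subseteq> {..<x}" using ex_fresh_array by blast
  define C where "C = 16 * (com_weight (decide_size x P) + 1)"
  have "decides_dominating_set \<sigma> \<delta> (decide_size x P)
      (\<lambda>p n. real C * (real n + 1) ^ 4 * (time p n + 1))"
    unfolding decides_dominating_set_def
  proof (intro allI impI, elim conjE)
    fix n G Q k assume hub: "hub_instance \<sigma> \<delta> n G Q" and "k \<le> n"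
    let ?xs = "encode_hub_graph n G Q"
    obtain T s where T: "exec_within P (input (n # ?xs)) T s" "real T \<le> time (card Q) n"
      and opt: "minimum_dominating_set G (output_set n s)"
      using assms hub unfolding solves_dominating_set_def exec_within_def by blast
    obtain U w where w: "exec (decide_size x P) (input (n # k # ?xs)) U w"
      "U \<le> C * (n + 1) ^ 4 * (T + 1)" "accepting w \<longleftrightarrow> card (output_set n s) \<le> k"
      using exec_within_decide_size[OF x length_encode_hub_graph set_encode_hub_graph \<open>k \<le> n\<close> T(1)]
      unfolding exec_within_def C_def by blast
    have "real U \<le> real (C * (n + 1) ^ 4 * (T + 1))" using w(2) by (rule of_nat_mono)
    also have "\<dots> = real C * (real n + 1) ^ 4 * (real T + 1)" by (simp add: algebra_simps)
    also have "\<dots> \<le> real C * (real n + 1) ^ 4 * (time (card Q) n + 1)"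
      using T(2) by (intro mult_left_mono) simp_all
    finally have "real U \<le> real C * (real n + 1) ^ 4 * (time (card Q) n + 1)" .
    moreover have "card (output_set n s) \<le> k \<longleftrightarrow> (\<exists>X. dominating_set G X \<and> card X \<le> k)"
      using opt unfolding minimum_dominating_set_def by (meson le_trans)
    ultimately show "\<exists>T s. exec (decide_size x P) (input (n # k # ?xs)) T s \<and>
        real T \<le> real C * (real n + 1) ^ 4 * (time (card Q) n + 1) \<and>
        (accepting s \<longleftrightarrow> (\<exists>X. dominating_set G X \<and> card X \<le> k))"
      using w by blast
  qed
  then show ?thesis by blast
qed


section \<open>Writing the graph of a set cover instance\<close>

definition cover_array :: "nat \<Rightarrow> nat set list \<Rightarrow> nat \<Rightarrow> nat \<Rightarrow> nat" where
  "cover_array n Fs t = input (encode_set_cover n Fs t) 0"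

definition cover_encoding :: "nat \<Rightarrow> nat set list \<Rightarrow> nat list" where
  "cover_encoding n Fs = encode_hub_graph (cover_order n Fs) (cover_graph n Fs) {..<n}"

lemma length_cover_encoding:
  "length (cover_encoding n Fs) = cover_order n Fs + cover_order n Fs * cover_order n Fs"
  by (simp add: cover_encoding_def length_encode_hub_graph)

lemma length_encode_set_cover: "length (encode_set_cover n Fs t) = 3 + length Fs * n"
  by (simp add: encode_set_cover_def length_concat_map)

lemma set_encode_set_cover: "set (encode_set_cover n Fs t) \<subseteq> {n, length Fs, t, 0, 1}"
  by (auto simp: encode_set_cover_def)

lemma cover_array_header [simp]:
  "cover_array n Fs t 0 = n"
  "cover_array n Fs t (Suc 0) = length Fs"
  "cover_array n Fs t 2 = t"
  by (simp_all add: cover_array_def input_0 length_encode_set_cover)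
    (simp_all add: encode_set_cover_def)

lemma cover_array_entry:
  assumes "j < length Fs" "u < n"
  shows "cover_array n Fs t (3 + (j * n + u)) = of_bool (u \<in> Fs ! j)"
proof -
  have "j * n + u < Suc j * n" using assms(2) by simp
  also have "\<dots> \<le> length Fs * n" using assms(1) by (intro mult_le_mono1) simp
  finally have "3 + (j * n + u) < length (encode_set_cover n Fs t)"
    by (simp add: length_encode_set_cover)
  moreover have "encode_set_cover n Fs t ! (3 + (j * n + u)) = of_bool (u \<in> Fs ! j)"
    unfolding encode_set_cover_def
    by (subst nth_append_right) (simp_all add: nth_concat_map[OF assms])
  ultimately show ?thesis by (simp add: cover_array_def input_0)
qed

text \<open>The new instance overwrites the old one entirely: what lies beyond its end is zero already.\<close>

lemma cover_array_beyond_hub_graph: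
  assumes "t \<le> length Fs" "cover_order n Fs + cover_order n Fs * cover_order n Fs \<le> i"
  shows "cover_array n Fs t i = 0"
proof (cases "length Fs = 0")
  case True
  then have "n \<le> i" "t = 0" using assms by simp_all
  consider (entry) "3 \<le> i" | (header) "i \<in> {0, Suc 0, 2}" by force
  then show ?thesis
  proof cases
    case entry
    then show ?thesis using True by (simp add: cover_array_def input_0 length_encode_set_cover)
  next
    case header
    then show ?thesis using True \<open>n \<le> i\<close> \<open>t = 0\<close> by auto
  qed
next
  case False
  have "length Fs * n \<le> cover_order n Fs * cover_order n Fs" by (intro mult_le_mono) simp_all
  then have "3 + length Fs * n \<le> i" using False assms(2) by (cases Fs) simp_all
  then show ?thesis by (simp add: cover_array_def input_0 length_encode_set_cover)
qed

lemma blen_bounded_input_encode_set_cover: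
  assumes "t \<le> length Fs" "cover_order n Fs + 1 < B"
  shows "blen_bounded B (input (encode_set_cover n Fs t))"
proof (rule blen_bounded_input)
  fix y assume "y \<in> set (encode_set_cover n Fs t)"
  then have "y \<in> {n, length Fs, t, 0, 1}" using set_encode_set_cover by blast
  then have "y < B" using assms by auto
  then show "blen y \<le> B" by (rule blen_le)
qed (use assms(2) in simp)

lemma blen_nth_cover_encoding:
  assumes "i < cover_order n Fs + cover_order n Fs * cover_order n Fs"
  shows "blen (cover_encoding n Fs ! i) = 1"
proof -
  have "cover_encoding n Fs ! i \<in> set (cover_encoding n Fs)"
    using assms by (simp add: length_cover_encoding)
  then have "cover_encoding n Fs ! i \<in> {0, 1}"
    using set_encode_hub_graph unfolding cover_encoding_def by blast
  then show ?thesis by (auto simp: blen_def)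
qed

definition if_exp :: "aexp \<Rightarrow> aexp \<Rightarrow> aexp \<Rightarrow> aexp" where
  "if_exp b e1 e2 = Op Add (Op Mul b e1) (Op Mul (Op Sub (Const 1) b) e2)"

definition mod_exp :: "aexp \<Rightarrow> aexp \<Rightarrow> aexp" where
  "mod_exp e1 e2 = Op Sub e1 (Op Mul (Op Div e1 e2) e2)"

definition order_exp :: "nat \<Rightarrow> aexp" where
  "order_exp x = Op Add (Var x) (Op Mul (Const 3) (Read x (Const 1)))"

definition budget_exp :: "nat \<Rightarrow> aexp" where
  "budget_exp x = Op Add (Read x (Const 1)) (Read x (Const 2))"

definition edge_exp :: "nat \<Rightarrow> aexp \<Rightarrow> aexp \<Rightarrow> aexp" where
  "edge_exp x u v = if_exp (Op Less u (Var x))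
     (if_exp (Op Less v (Var x)) (Const 0)
       (if_exp (Op Less v (Op Add (Var x) (Read x (Const 1))))
         (Read x (Op Add (Const 3) (Op Add (Op Mul (Op Sub v (Var x)) (Var x)) u)))
         (Const 0)))
     (Op Eq v (Op Add u (Read x (Const 1))))"

definition adjacency_exp :: "nat \<Rightarrow> aexp \<Rightarrow> aexp \<Rightarrow> aexp" where
  "adjacency_exp x u v = Op Less (Const 0) (Op Add (edge_exp x u v) (edge_exp x v u))"

definition entry_exp :: "nat \<Rightarrow> aexp \<Rightarrow> aexp" where
  "entry_exp x j = if_exp (Op Less j (order_exp x)) (Op Less j (Var x))
     (adjacency_exp x (Op Div (Op Sub j (order_exp x)) (order_exp x))
       (mod_exp (Op Sub j (order_exp x)) (order_exp x)))"

lemma aval_if_exp [simp]: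
  "aval b s \<le> 1 \<Longrightarrow> aval (if_exp b e1 e2) s = (if 0 < aval b s then aval e1 s else aval e2 s)"
  by (cases "aval b s = 0") (simp_all add: if_exp_def le_Suc_eq)

lemma aval_mod_exp [simp]: "aval (mod_exp e1 e2) s = aval e1 s mod aval e2 s"
  by (simp add: mod_exp_def minus_div_mult_eq_mod)

lemma aval_order_exp: "s x = cover_array n Fs t \<Longrightarrow> aval (order_exp x) s = cover_order n Fs"
  by (simp add: order_exp_def)

lemma aval_budget_exp: "s x = cover_array n Fs t \<Longrightarrow> aval (budget_exp x) s = length Fs + t"
  by (simp add: budget_exp_def)

lemma aval_edge_exp:
  assumes "s x = cover_array n Fs t"
  shows "aval (edge_exp x u v) s = of_bool (cover_edge n Fs (aval u s) (aval v s))"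
proof -
  have "cover_array n Fs t (3 + ((aval v s - n) * n + aval u s)) =
      of_bool (aval u s \<in> Fs ! (aval v s - n))"
    if "aval u s < n" "n \<le> aval v s" "aval v s < n + length Fs"
    using that by (intro cover_array_entry) simp_all
  then show ?thesis by (simp add: edge_exp_def cover_edge_def assms)
qed

lemma aval_entry_exp:
  fixes n Fs
  defines "N \<equiv> cover_order n Fs"
  assumes x: "s x = cover_array n Fs t" and less: "aval j s < N + N * N"
  shows "aval (entry_exp x j) s = cover_encoding n Fs ! aval j s"
proof (cases "aval j s < N")
  case True
  then show ?thesis using less
    by (simp add: entry_exp_def cover_encoding_def nth_encode_hub_graph aval_order_exp[of s x, OF x]
        x flip: N_def)
next
  case False
  define k where "k = aval j s - N"
  have "k div N < N" using False less by (simp add: k_def less_mult_imp_div_less)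
  moreover from this have "k mod N < N" by simp
  ultimately show ?thesis using False less
    by (simp add: entry_exp_def adjacency_exp_def cover_encoding_def nth_encode_hub_graph
        aval_order_exp[of s x, OF x] aval_edge_exp[of s x, OF x] flip: N_def k_def)
qed

text \<open>Array \<open>x\<close> keeps the set cover instance, array \<open>x + 1\<close> the loop counter.\<close>

definition copy_input :: "nat \<Rightarrow> com" where
  "copy_input x = for_loop (x + 1) (Op Add (Const 3) (Op Mul (Read 0 (Const 1)) (Var 0)))
     (Write x (Var (x + 1)) (Read 0 (Var (x + 1))))"

definition write_graph :: "nat \<Rightarrow> com" where
  "write_graph x = for_loop (x + 1) (Op Add (order_exp x) (Op Mul (order_exp x) (order_exp x)))
     (Write 0 (Op Add (Const 2) (Var (x + 1))) (entry_exp x (Var (x + 1))))"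

definition write_header :: "nat \<Rightarrow> com" where
  "write_header x = Seq (Write 0 (Const 0) (order_exp x)) (Write 0 (Const 1) (budget_exp x))"

definition write_hub_instance :: "nat \<Rightarrow> com" where
  "write_hub_instance x = Seq (write_graph x) (write_header x)"

lemma exec_within_copy_input:
  fixes n Fs t
  defines "l \<equiv> 3 + length Fs * n" and "s \<equiv> input (encode_set_cover n Fs t)"
  assumes "0 < x" and bounded: "blen_bounded B s" "blen l \<le> B"
  shows "exec_within (copy_input x) s (com_weight (copy_input x) * (l + 1) * B)
    (store (x + 1) 0 l (s(x := cover_array n Fs t)))"
proof -
  define g where "g k = s(x := \<lambda>i. if i < k then cover_array n Fs t i else 0)" for k
  have s0: "s 0 = cover_array n Fs t" by (simp add: s_def cover_array_def)
  have "g 0 = s" using \<open>0 < x\<close> by (auto simp: g_def s_def input_neq_0 fun_eq_iff)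
  moreover have "g l = s(x := cover_array n Fs t)"
    by (auto simp: g_def l_def cover_array_def input_0 length_encode_set_cover fun_eq_iff)
  moreover have "exec_within (copy_input x) (g 0) (com_weight (copy_input x) * (l + 1) * B)
      (store (x + 1) 0 l (g l))"
    unfolding copy_input_def
  proof (rule exec_within_for_loop_Write)
    show "blen_bounded B (g k)" for k
    proof -
      have "blen 0 \<le> B" using bounded(2) blen_mono[of 0 l] by linarith
      then show ?thesis
        unfolding g_def s0[symmetric] using bounded(1)
        by (intro blen_bounded_update) (auto simp: blen_bounded_def)
    qed
  qed (use \<open>0 < x\<close> bounded(2) s0 in \<open>auto simp: g_def l_def fun_eq_iff less_Suc_eq\<close>)
  ultimately show ?thesis by simp
qed

lemma exec_within_write_graph:
  fixes n Fs
  defines "N \<equiv> cover_order n Fs"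
  assumes "0 < x" and x: "s x = cover_array n Fs t"
    and bounded: "blen_bounded B s" "blen (N + N * N) \<le> B"
  shows "exec_within (write_graph x) s (com_weight (write_graph x) * (N + N * N + 1) * B)
    (store (x + 1) 0 (N + N * N)
      (s(0 := \<lambda>i. if 2 \<le> i \<and> i < N + N * N + 2 then cover_encoding n Fs ! (i - 2) else s 0 i)))"
proof -
  define g where
    "g k = s(0 := \<lambda>i. if 2 \<le> i \<and> i < k + 2 then cover_encoding n Fs ! (i - 2) else s 0 i)" for k
  have "g 0 = s" by (auto simp: g_def fun_eq_iff)
  moreover have "exec_within (write_graph x) (g 0)
      (com_weight (write_graph x) * (N + N * N + 1) * B)
      (store (x + 1) 0 (N + N * N) (g (N + N * N)))"
    unfolding write_graph_def
  proof (rule exec_within_for_loop_Write)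
    fix k
    let ?s = "store (x + 1) 0 k (g k)"
    have x: "?s x = cover_array n Fs t" using \<open>0 < x\<close> x by (simp add: g_def)
    show "aval (Op Add (order_exp x) (Op Mul (order_exp x) (order_exp x))) ?s = N + N * N"
      by (simp only: aval.simps apply_op.simps aval_order_exp[of ?s x, OF x] N_def)
    show "blen_bounded B (g k)" if "k \<le> N + N * N"
      unfolding g_def using that bounded blen_pos[of "N + N * N"]
      by (intro blen_bounded_update)
        (auto simp: blen_bounded_def blen_nth_cover_encoding N_def Suc_le_eq)
    assume "k < N + N * N"
    then have "aval (entry_exp x (Var (x + 1))) ?s = cover_encoding n Fs ! k"
      using aval_entry_exp[of ?s x, OF x, of "Var (x + 1)"] by (simp add: N_def)
    moreover have "aval (Op Add (Const 2) (Var (x + 1))) ?s = k + 2" by simp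
    moreover have "store 0 (k + 2) (cover_encoding n Fs ! k) ?s = store (x + 1) 0 k (g (Suc k))"
      by (auto simp: g_def fun_eq_iff less_Suc_eq)
    ultimately show "store 0 (aval (Op Add (Const 2) (Var (x + 1))) ?s)
        (aval (entry_exp x (Var (x + 1))) ?s) ?s = store (x + 1) 0 k (g (Suc k))"
      by (simp only:)
  qed (rule bounded(2))
  ultimately show ?thesis by (simp add: g_def)
qed

lemma exec_within_write_header:
  assumes "0 < x" and x: "s x = cover_array n Fs t"
    and bounded: "blen_bounded B s" "blen (cover_order n Fs) \<le> B"
  shows "exec_within (write_header x) s (com_weight (write_header x) * B)
    (store 0 1 (length Fs + t) (store 0 0 (cover_order n Fs) s))"
proof -
  let ?s1 = "store 0 0 (cover_order n Fs) s"
  have s1: "blen_bounded B ?s1" "?s1 x = cover_array n Fs t"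
    using assms by (auto intro: blen_bounded_store)
  have "exec_within (Write 0 (Const 0) (order_exp x)) s
      (com_weight (Write 0 (Const 0) (order_exp x)) * B) ?s1"
    using exec_within_Write[OF bounded(1), of 0 "Const 0" "order_exp x"]
    by (simp add: aval_order_exp[of s x, OF x])
  moreover have "exec_within (Write 0 (Const 1) (budget_exp x)) ?s1
      (com_weight (Write 0 (Const 1) (budget_exp x)) * B) (store 0 1 (length Fs + t) ?s1)"
    using exec_within_Write[OF s1(1), of 0 "Const 1" "budget_exp x"]
    by (simp only: aval_budget_exp[of ?s1 x, OF s1(2)] aval.simps)
  ultimately show ?thesis unfolding write_header_def by (rule exec_within_Seq_weight)
qed

lemma exec_within_write_hub_instance:
  fixes n Fs
  defines "N \<equiv> cover_order n Fs"
  assumes "0 < x" "t \<le> length Fs"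
    and arrays: "s x = cover_array n Fs t" "s 0 = cover_array n Fs t"
    and bounded: "blen_bounded B s" "blen (N + N * N) \<le> B"
  shows "exec_within (write_hub_instance x) s
    (com_weight (write_hub_instance x) * (N + N * N + 1) * B)
    (store (x + 1) 0 (N + N * N) (s(0 := input (N # (length Fs + t) # cover_encoding n Fs) 0)))"
proof -
  let ?graph = "\<lambda>i. if 2 \<le> i \<and> i < N + N * N + 2 then cover_encoding n Fs ! (i - 2) else s 0 i"
  let ?s1 = "store (x + 1) 0 (N + N * N) (s(0 := ?graph))"
  let ?s2 = "store 0 1 (length Fs + t) (store 0 0 N ?s1)"
  have "1 \<le> B" using bounded(2) blen_pos[of "N + N * N"] by linarith
  then have "blen_bounded B (s(0 := ?graph))"
    using bounded(1) blen_nth_cover_encoding[of _ n Fs]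
    by (intro blen_bounded_update) (auto simp: blen_bounded_def N_def)
  then have s1: "blen_bounded B ?s1" using bounded(2) by (rule blen_bounded_store)
  have "blen (cover_order n Fs) \<le> B"
    using bounded(2) blen_mono[of N "N + N * N"] unfolding N_def by linarith
  then have "exec_within (write_header x) ?s1 (com_weight (write_header x) * B) ?s2"
    using \<open>0 < x\<close> arrays(1) s1 unfolding N_def by (intro exec_within_write_header) simp_all
  moreover have "exec_within (write_graph x) s
      (com_weight (write_graph x) * (N + N * N + 1) * B) ?s1"
    using \<open>0 < x\<close> arrays(1) bounded unfolding N_def by (intro exec_within_write_graph)
  ultimately have exec: "exec_within (write_hub_instance x) s
      (com_weight (write_graph x) * (N + N * N + 1) * B + com_weight (write_header x) * B) ?s2"
    unfolding write_hub_instance_def using exec_within_Seq by blast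
  have "?s2 = store (x + 1) 0 (N + N * N)
      (s(0 := input (N # (length Fs + t) # cover_encoding n Fs) 0))"
    using cover_array_beyond_hub_graph[OF \<open>t \<le> length Fs\<close>]
    by (auto simp: fun_eq_iff input_0 nth_Cons' length_cover_encoding arrays(2) N_def
        numeral_2_eq_2)
  then show ?thesis
    using exec_within_mono[OF exec, of "com_weight (write_hub_instance x) * (N + N * N + 1) * B"]
    by (simp add: write_hub_instance_def algebra_simps)
qed

definition reduce_set_cover :: "nat \<Rightarrow> com" where
  "reduce_set_cover x = Seq (copy_input x) (write_hub_instance x)"

lemma exec_within_reduce_set_cover:
  fixes n Fs
  defines "N \<equiv> cover_order n Fs"
  assumes "0 < x" "t \<le> length Fs"
  shows "\<exists>s. exec_within (reduce_set_cover x) (input (encode_set_cover n Fs t))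
      (16 * com_weight (reduce_set_cover x) * (N + 1) ^ 4) s \<and>
    (\<forall>a<x. s a = input (N # (length Fs + t) # cover_encoding n Fs) a)"
proof (intro exI conjI)
  define B where "B = memory_bound N"
  note less = less_memory_bound[of _ N, folded B_def]
  define l where "l = 3 + length Fs * n"
  have "length Fs * n \<le> N * N" unfolding N_def by (intro mult_le_mono) simp_all
  then have "l < B" by (intro less) (simp add: l_def)
  have graph_length: "blen (N + N * N) \<le> B" by (intro blen_le less) simp
  let ?s0 = "input (encode_set_cover n Fs t)"
  let ?s1 = "store (x + 1) 0 l (?s0(x := cover_array n Fs t))"
  let ?s2 = "store (x + 1) 0 (N + N * N)
    (?s1(0 := input (N # (length Fs + t) # cover_encoding n Fs) 0))"
  have s0: "blen_bounded B ?s0"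
    by (rule blen_bounded_input_encode_set_cover[OF \<open>t \<le> length Fs\<close>]) (simp add: less flip: N_def)
  then have "blen_bounded B (?s0(x := cover_array n Fs t))"
    by (intro blen_bounded_update) (auto simp: blen_bounded_def cover_array_def)
  then have s1: "blen_bounded B ?s1" using blen_le[OF \<open>l < B\<close>] by (rule blen_bounded_store)
  have "exec_within (copy_input x) ?s0 (com_weight (copy_input x) * (l + 1) * B) ?s1"
    unfolding l_def using s0 blen_le[OF \<open>l < B\<close>]
    by (intro exec_within_copy_input \<open>0 < x\<close>) (simp_all add: l_def)
  then have "exec_within (copy_input x) ?s0 (com_weight (copy_input x) * B\<^sup>2) ?s1"
    by (rule exec_within_weight_power2) (use \<open>l < B\<close> in simp)
  moreover have "?s1 0 = cover_array n Fs t" using \<open>0 < x\<close> by (simp add: cover_array_def)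
  then have "exec_within (write_hub_instance x) ?s1
      (com_weight (write_hub_instance x) * (N + N * N + 1) * B) ?s2"
    unfolding N_def using graph_length s1
    by (intro exec_within_write_hub_instance[OF \<open>0 < x\<close> \<open>t \<le> length Fs\<close>]) (simp_all add: N_def)
  then have "exec_within (write_hub_instance x) ?s1 (com_weight (write_hub_instance x) * B\<^sup>2) ?s2"
    by (rule exec_within_weight_power2) (use less[of "N + N * N + 1"] in simp)
  ultimately have "exec_within (reduce_set_cover x) ?s0 (com_weight (reduce_set_cover x) * B\<^sup>2) ?s2"
    unfolding reduce_set_cover_def by (rule exec_within_Seq_weight)
  then show "exec_within (reduce_set_cover x) ?s0
      (16 * com_weight (reduce_set_cover x) * (N + 1) ^ 4) ?s2"
    by (simp add: B_def power2_memory_bound mult_ac)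
qed (use \<open>0 < x\<close> in \<open>auto simp: input_neq_0\<close>)


section \<open>Single-exponential time bounds\<close>

lemma hub_instance_edgeless: "hub_instance \<sigma> \<delta> n \<lparr>pverts = {..<n}, parcs = {}\<rparr> {..<n}"
proof -
  let ?G = "\<lparr>pverts = {..<n}, parcs = {}\<rparr>"
  have "pair_graph ?G" by unfold_locales (simp_all add: symmetric_def sym_def)
  moreover have "is_hub \<sigma> \<delta> ?G {..<n}" by (rule is_hub_of_fibers) simp_all
  ultimately show ?thesis by (simp add: hub_instance_def)
qed

text \<open>
  The edgeless graphs with no and with one vertex, all in the hub, force \<open>K > 0\<close> and \<open>b K > 0\<close>.
\<close>

lemma time_bound_pos:
  fixes b K :: real
  assumes "\<And>n G Q. hub_instance \<sigma> \<delta> n G Q \<Longrightarrow> \<exists>T>0. real T \<le> b ^ card Q * (K * (real n + 1) ^ c)"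
  shows "0 < K" "0 < b"
proof -
  have pos: "0 < b ^ n * (K * (real n + 1) ^ c)" for n
    using assms[OF hub_instance_edgeless[of _ _ n]] by (auto intro: less_le_trans)
  show "0 < K" using pos[of 0] by simp
  then have "0 < K * (real 1 + 1) ^ c" by simp
  with pos[of 1] show "0 < b" unfolding power_one_right by (rule zero_less_mult_pos2)
qed

lemma max_one_base_le:
  fixes b K :: real
  assumes "0 < K" "0 < b"
  shows "b ^ p * (K * (real n + 1) ^ c) \<le> max 1 b ^ p * (K * (real n + 1) ^ c)"
  using assms by (intro mult_right_mono power_mono) simp_all

lemma decides_dominating_set_mono:
  assumes "decides_dominating_set \<sigma> \<delta> P time" "\<And>p n. time p n \<le> time' p n"
  shows "decides_dominating_set \<sigma> \<delta> P time'"
  using assms unfolding decides_dominating_set_def by (meson order_trans)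

lemma solves_dominating_set_mono:
  assumes "solves_dominating_set \<sigma> \<delta> P time" "\<And>p n. time p n \<le> time' p n"
  shows "solves_dominating_set \<sigma> \<delta> P time'"
  using assms unfolding solves_dominating_set_def by (meson order_trans)

lemma solves_dominating_set_max_one_base:
  fixes b K :: real
  assumes "solves_dominating_set \<sigma> \<delta> P (\<lambda>p n. b ^ p * (K * (real n + 1) ^ c))"
  shows "0 \<le> K" "solves_dominating_set \<sigma> \<delta> P (\<lambda>p n. max 1 b ^ p * (K * (real n + 1) ^ c))"
proof -
  have "\<exists>T>0. real T \<le> b ^ card Q * (K * (real n + 1) ^ c)" if "hub_instance \<sigma> \<delta> n G Q" for n G Q
    using assms that unfolding solves_dominating_set_def by (meson exec_time_pos)
  then have pos: "0 < K" "0 < b" using time_bound_pos by blast+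
  show "0 \<le> K" using pos(1) by simp
  show "solves_dominating_set \<sigma> \<delta> P (\<lambda>p n. max 1 b ^ p * (K * (real n + 1) ^ c))"
    by (rule solves_dominating_set_mono[OF assms max_one_base_le[OF pos]])
qed

lemma decides_dominating_set_max_one_base:
  fixes b K :: real
  assumes "decides_dominating_set \<sigma> \<delta> P (\<lambda>p n. b ^ p * (K * (real n + 1) ^ c))"
  shows "0 \<le> K" "decides_dominating_set \<sigma> \<delta> P (\<lambda>p n. max 1 b ^ p * (K * (real n + 1) ^ c))"
proof -
  have "\<exists>T>0. real T \<le> b ^ card Q * (K * (real n + 1) ^ c)" if "hub_instance \<sigma> \<delta> n G Q" for n G Q
    using assms that unfolding decides_dominating_set_def by (meson exec_time_pos le0)
  then have pos: "0 < K" "0 < b" using time_bound_pos by blast+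
  show "0 \<le> K" using pos(1) by simp
  show "decides_dominating_set \<sigma> \<delta> P (\<lambda>p n. max 1 b ^ p * (K * (real n + 1) ^ c))"
    by (rule decides_dominating_set_mono[OF assms max_one_base_le[OF pos]])
qed

lemma polynomial_overhead_le:
  fixes b C K y :: real
  assumes "1 \<le> b" "0 \<le> C" "0 \<le> K" "1 \<le> y"
  shows "C * y ^ k * (b ^ p * (K * y ^ c) + 1) \<le> b ^ p * (C * (K + 1) * y ^ (k + c))"
proof -
  have "1 \<le> b ^ p" "1 \<le> y ^ c" using assms by simp_all
  then have "1 * 1 \<le> b ^ p * y ^ c" by (intro mult_mono) simp_all
  then have "b ^ p * (K * y ^ c) + 1 \<le> b ^ p * (K + 1) * y ^ c" by (simp add: algebra_simps)
  then have "C * y ^ k * (b ^ p * (K * y ^ c) + 1) \<le> C * y ^ k * (b ^ p * (K + 1) * y ^ c)"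
    using assms by (intro mult_left_mono) simp_all
  then show ?thesis by (simp add: power_add mult_ac)
qed


section \<open>From Set Cover to Dominating Set\<close>

lemma exec_reduce_set_cover_then_decide:
  assumes "decides_dominating_set 3 d P time" "2 \<le> x" "com_arrays P \<subseteq> {..<x}"
    and "set_cover_instance d {..<n} (set Fs)" "t \<le> length Fs"
  shows "\<exists>T s. exec (Seq (reduce_set_cover x) P) (input (encode_set_cover n Fs t)) T s \<and>
    real T \<le> real (16 * com_weight (reduce_set_cover x) + 1) * (real (cover_order n Fs) + 1) ^ 4
      * (time n (cover_order n Fs) + 1) \<and>
    (accepting s \<longleftrightarrow> has_set_cover {..<n} (set Fs) t)"
proof -
  let ?N = "cover_order n Fs" and ?W = "com_weight (reduce_set_cover x)"
  have "length Fs + t \<le> ?N" using assms(5) by simp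
  then obtain T s where P: "exec_within P (input (?N # (length Fs + t) # cover_encoding n Fs)) T s"
    and T: "real T \<le> time n ?N"
    and s: "accepting s \<longleftrightarrow> (\<exists>X. dominating_set (cover_graph n Fs) X \<and> card X \<le> length Fs + t)"
    using assms(1) hub_instance_cover_graph[OF assms(4)]
    unfolding decides_dominating_set_def cover_encoding_def exec_within_def
    by (metis card_lessThan order_refl)
  have "0 < x" using assms(2) by simp
  then obtain u where u: "exec_within (reduce_set_cover x) (input (encode_set_cover n Fs t))
      (16 * ?W * (?N + 1) ^ 4) u" "\<forall>a<x. u a = input (?N # (length Fs + t) # cover_encoding n Fs) a"
    using exec_within_reduce_set_cover[OF _ assms(5)] by blast
  have "exec_within P u T (override_on u s {..<x})"
    using u(2) by (intro exec_within_override_on[OF P assms(3)]) simp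
  from exec_within_Seq[OF u(1) this] obtain U where
    U: "exec (Seq (reduce_set_cover x) P) (input (encode_set_cover n Fs t)) U
      (override_on u s {..<x})"
      "U \<le> 16 * ?W * (?N + 1) ^ 4 + T"
    unfolding exec_within_def by blast
  have "T \<le> (?N + 1) ^ 4 * (T + 1)" using mult_le_mono[of 1 "(?N + 1) ^ 4" T "T + 1"] by simp
  then have "16 * ?W * (?N + 1) ^ 4 + T \<le> (16 * ?W + 1) * (?N + 1) ^ 4 * (T + 1)"
    by (simp add: algebra_simps)
  with U(2) have "real U \<le> real ((16 * ?W + 1) * (?N + 1) ^ 4 * (T + 1))"
    by (intro of_nat_mono) linarith
  also have "\<dots> = real (16 * ?W + 1) * (real ?N + 1) ^ 4 * (real T + 1)" by (simp add: algebra_simps)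
  also have "\<dots> \<le> real (16 * ?W + 1) * (real ?N + 1) ^ 4 * (time n ?N + 1)"
    using T by (intro mult_left_mono) simp_all
  finally have "real U \<le> real (16 * ?W + 1) * (real ?N + 1) ^ 4 * (time n ?N + 1)" .
  moreover have "\<Union>(set Fs) = {..<n}" using assms(4) by (simp add: set_cover_instance_def)
  then have "accepting (override_on u s {..<x}) \<longleftrightarrow> has_set_cover {..<n} (set Fs) t"
    using s assms(2) by (simp add: accepting_def dominating_set_cover_graph_iff)
  ultimately show ?thesis using U(1) by blast
qed

lemma cover_order_le:
  assumes "set_cover_instance d {..<n} (set Fs)" "distinct Fs"
  shows "real (cover_order n Fs) + 1 \<le> 4 * (real n + 1) ^ (d + 1)"
proof -
  have "length Fs \<le> (n + 1) ^ d" using length_set_cover_family_le[OF assms] by simp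
  also have "\<dots> \<le> (n + 1) ^ (d + 1)" by (rule power_increasing) simp_all
  finally have "length Fs \<le> (n + 1) ^ (d + 1)" .
  moreover have "n + 1 \<le> (n + 1) ^ (d + 1)" by (rule self_le_power) simp_all
  ultimately have "cover_order n Fs + 1 \<le> 4 * (n + 1) ^ (d + 1)" by linarith
  then have "real (cover_order n Fs + 1) \<le> real (4 * (n + 1) ^ (d + 1))" by (rule of_nat_mono)
  then show ?thesis by (simp add: algebra_simps)
qed

lemma solves_set_cover_of_decides_dominating_set:
  fixes b K :: real
  assumes "decides_dominating_set 3 d P (\<lambda>p n. b ^ p * (K * (real n + 1) ^ c))"
  shows "\<exists>P' (K'::real) c'. solves_set_cover d P' (\<lambda>n. max 1 b ^ n * (K' * (real n + 1) ^ c'))"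
proof -
  define b' where "b' = max 1 b"
  note lifted = decides_dominating_set_max_one_base[OF assms, folded b'_def]
  have "1 \<le> b'" by (simp add: b'_def)
  obtain x where x: "2 \<le> x" "com_arrays P \<subseteq> {..<x}" using ex_fresh_array by blast
  define C where "C = real (16 * com_weight (reduce_set_cover x) + 1)"
  let ?K = "C * (K + 1) * 4 ^ (4 + c)" and ?c = "(d + 1) * (4 + c)"
  have "solves_set_cover d (Seq (reduce_set_cover x) P) (\<lambda>n. b' ^ n * (?K * (real n + 1) ^ ?c))"
    unfolding solves_set_cover_def
  proof (intro allI impI, elim conjE)
    fix n t :: nat and Fs :: "nat set list"
    assume inst: "set_cover_instance d {..<n} (set Fs)" "distinct Fs" and t: "t \<le> length Fs"
    define y where "y = real (cover_order n Fs) + 1"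
    obtain T s where s: "exec (Seq (reduce_set_cover x) P) (input (encode_set_cover n Fs t)) T s"
      "accepting s \<longleftrightarrow> has_set_cover {..<n} (set Fs) t"
      and T: "real T \<le> C * y ^ 4 * (b' ^ n * (K * y ^ c) + 1)"
      using exec_reduce_set_cover_then_decide[OF lifted(2) x inst(1) t]
      unfolding C_def y_def by auto
    have "0 \<le> C" "1 \<le> y" by (simp_all add: C_def y_def)
    note T
    also have "C * y ^ 4 * (b' ^ n * (K * y ^ c) + 1) \<le> b' ^ n * (C * (K + 1) * y ^ (4 + c))"
      by (rule polynomial_overhead_le) (use \<open>1 \<le> b'\<close> lifted(1) \<open>0 \<le> C\<close> \<open>1 \<le> y\<close> in simp_all)
    also have "\<dots> \<le> b' ^ n * (C * (K + 1) * (4 * (real n + 1) ^ (d + 1)) ^ (4 + c))"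
      using cover_order_le[OF inst] \<open>1 \<le> b'\<close> lifted(1) \<open>0 \<le> C\<close> \<open>1 \<le> y\<close>
      by (intro mult_left_mono power_mono) (simp_all add: y_def)
    also have "\<dots> = b' ^ n * (?K * (real n + 1) ^ ?c)"
      by (simp only: power_mult_distrib power_mult mult.assoc)
    finally have "real T \<le> b' ^ n * (?K * (real n + 1) ^ ?c)" .
    with s show "\<exists>T s. exec (Seq (reduce_set_cover x) P) (input (encode_set_cover n Fs t)) T s \<and>
        real T \<le> b' ^ n * (?K * (real n + 1) ^ ?c) \<and>
        (accepting s \<longleftrightarrow> has_set_cover {..<n} (set Fs) t)"
      by blast
  qed
  then show ?thesis unfolding b'_def by blast
qed

lemma decides_of_solves_dominating_set_exponential:
  fixes b K :: real
  assumes "solves_dominating_set \<sigma> \<delta> P (\<lambda>p n. b ^ p * (K * (real n + 1) ^ c))"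
  shows "\<exists>P' (K'::real) c'.
    decides_dominating_set \<sigma> \<delta> P' (\<lambda>p n. max 1 b ^ p * (K' * (real n + 1) ^ c'))"
proof -
  note lifted = solves_dominating_set_max_one_base[OF assms]
  obtain P' C where "decides_dominating_set \<sigma> \<delta> P'
      (\<lambda>p n. real C * (real n + 1) ^ 4 * (max 1 b ^ p * (K * (real n + 1) ^ c) + 1))"
    using decides_of_solves_dominating_set[OF lifted(2)] by blast
  then have "decides_dominating_set \<sigma> \<delta> P'
      (\<lambda>p n. max 1 b ^ p * (real C * (K + 1) * (real n + 1) ^ (4 + c)))"
    by (rule decides_dominating_set_mono) (use lifted(1) in \<open>intro polynomial_overhead_le; simp\<close>)
  then show ?thesis by blast
qed

lemma solves_set_cover_of_solves_dominating_set:
  fixes b K :: real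
  assumes "solves_dominating_set 3 d P (\<lambda>p n. b ^ p * (K * (real n + 1) ^ c))"
  shows "\<exists>P' (K'::real) c'. solves_set_cover d P' (\<lambda>n. max 1 b ^ n * (K' * (real n + 1) ^ c'))"
proof -
  obtain P' c' and K' :: real
    where "decides_dominating_set 3 d P' (\<lambda>p n. max 1 b ^ p * (K' * (real n + 1) ^ c'))"
    using decides_of_solves_dominating_set_exponential[OF assms] by blast
  from solves_set_cover_of_decides_dominating_set[OF this] show ?thesis by simp
qed

theorem theorem10p1:
  assumes SCC
  shows "\<forall>\<epsilon>>0. \<exists>\<delta>.
    \<not> (\<exists>P (K::real) (c::nat). solves_dominating_set 3 \<delta> P
          (\<lambda>p n. (2 - \<epsilon>) ^ p * (K * (real n + 1) ^ c))) \<and>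
    \<not> (\<exists>P (K::real) (c::nat). decides_dominating_set 3 \<delta> P
          (\<lambda>p n. (2 - \<epsilon>) ^ p * (K * (real n + 1) ^ c)))"
proof (intro allI impI)
  fix \<epsilon> :: real assume "\<epsilon> > 0"
  have "max 1 (2 - \<epsilon>) = 2 - min \<epsilon> 1" by (simp add: min_def max_def)
  then obtain d where "\<nexists>P (K::real) (c::nat).
      solves_set_cover d P (\<lambda>n. max 1 (2 - \<epsilon>) ^ n * (K * (real n + 1) ^ c))"
    using assms \<open>\<epsilon> > 0\<close> unfolding SCC_def by (metis min_less_iff_conj zero_less_one)
  then show "\<exists>\<delta>.
    \<not> (\<exists>P (K::real) (c::nat). solves_dominating_set 3 \<delta> P
          (\<lambda>p n. (2 - \<epsilon>) ^ p * (K * (real n + 1) ^ c))) \<and>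
    \<not> (\<exists>P (K::real) (c::nat). decides_dominating_set 3 \<delta> P
          (\<lambda>p n. (2 - \<epsilon>) ^ p * (K * (real n + 1) ^ c)))"
    using solves_set_cover_of_solves_dominating_set[of d]
      solves_set_cover_of_decides_dominating_set[of d] by blast
qed

end
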